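(* Let $\mathcal{T}$ be a well-behaved weakly column-closed family of fillings and let $\sigma:\mathcal{T}\to\mathbb{N}^s$ be an affine statistic. Let $D$ be a fixed (finite) diagram and $n\ge 1$ an integer, and define for every diagram $D'$ $$H_{D'}(\mathbf{z})=\sum_{T\in\mathcal{T}(D',n)}\mathbf{z}^{\sigma(T)},$$ where $\mathcal{T}(D',n)$ is the set of all fillings in $\mathcal{T}$ of shape $D'$ with $1\le T(i,j)\le n$ for every box $(i,j)$. Then $\{H_{kD}(\mathbf{z})\}_{k=1}^\infty$ satisfies a linear recurrence. Furthermore, if $\sigma$ is linear, then the characteristic polynomial of the recurrence is given by $$\prod_T\left(t-\mathbf{z}^{\sigma(T)}\right),$$ where $T$ runs over all fillings of shape $D$ such that any two adjacent columns of the same shape in $T$ are identical and such that $T$ can be obtained from some element of $\mathcal{T}(kD,n)$, for some $k\geq 1$, by deleting some columns. (Such $T$ need not itself be an element of $\mathcal{T}$; $\sigma(T)$ is then defined by linearity.) However, if $\mathcal{T}$ is strictly column-closed, then each such $T$ is in $\mathcal{T}(D,n)$.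
   Context: A diagram $D$ is a finite subset of $\{(i,j):i,j\ge1\}$ ($i$ = row, $j$ = column). $kD=\bigcup_{(i,j)\in D}\{(i,kj-k+1),\dots,(i,kj)\}$ is obtained from $D$ by repeating each column $k$ times. A filling of shape $D$ is a map $T:D\to\mathbb{N}$; it is viewed as the concatenation $(C_1,\dots,C_l)$ of its (filled) columns, some possibly empty. The shape of a column is the set of rows in which it has a box. $(m_1C_1,\dots,m_lC_l)$ denotes the filling with $m_1$ copies of $C_1$, followed by $m_2$ copies of $C_2$, etc. A family $\mathcal{T}$ of fillings is weakly column-closed if for all integers $m_i\ge1$: $(C_1,\dots,C_l)\in\mathcal{T}$ if and only if $(m_1C_1,\dots,m_lC_l)\in\mathcal{T}$. It is strictly column-closed if, in addition, it is closed under deletion of any column. $\mathcal{T}$ is well-behaved if every $T\in\mathcal{T}$ satisfies: (i) if two columns in $T$ are identical, then all columns in between are also identical to these two; (ii) if two columns $C_1\ne C_2$ appear in $T$ with $C_1$ somewhere to the left of $C_2$, then $C_1$ never appears to the right of $C_2$ in any other filling $T'\in\mathcal{T}$. A statistic $\sigma:\mathcal{T}\to\mathbb{N}^s$ ($\mathbb{N}$ includes $0$) on a weakly column-closed family is affine if for every $(C_1,\dots,C_l)\in\mathcal{T}$ there are vectors $A,S_1,\dots,S_l\in\mathbb{N}^s$ with $\sigma(m_1C_1,\dots,m_lC_l)=A+m_1S_1+\dots+m_lS_l$ for all $m_i\ge1$. It is linear if it is additive over columns: each column $C$ has a value $\sigma(C)\in\mathbb{N}^s$, depending only on $C$, such that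 $\sigma(m_1C_1,\dots,m_lC_l)=m_1\sigma(C_1)+\dots+m_l\sigma(C_l)$ (so $\sigma$ is additive under concatenation); this formula also defines $\sigma$ on concatenations of such columns that are not in $\mathcal{T}$. For $\mathbf{z}=(z_1,\dots,z_s)$, $\mathbf{z}^v=\prod z_i^{v_i}$. A sequence $\{a_k\}_{k\ge k_0}$ of polynomials in $\mathbf{z}$ satisfies a linear recurrence (of length $r$) with characteristic polynomial $t^r+c_1t^{r-1}+\dots+c_r$ if the $c_i$ are polynomials in $\mathbf{z}$ independent of $k$ and $a_k+c_1a_{k-1}+\dots+c_ra_{k-r}=0$ for all $k\ge k_0+r$. *)

theory Defs
  imports
    "HOL-Library.Poly_Mapping"
    "HOL-Library.Sublist"
    "HOL-Computational_Algebra.Polynomial"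
begin

definition diagram :: "(nat \<times> nat) set \<Rightarrow> bool" where
  "diagram D \<longleftrightarrow> finite D \<and> (\<forall>(i, j) \<in> D. 1 \<le> i \<and> 1 \<le> j)"

definition repeat_columns :: "nat \<Rightarrow> (nat \<times> nat) set \<Rightarrow> (nat \<times> nat) set" where
  "repeat_columns k D = (\<Union>(i, j) \<in> D. {i} \<times> {k * j - k + 1 .. k * j})"

text \<open>
  A filling is a partial map whose domain is its shape. In the same way a filled column is a
  partial map from rows to entries; its shape is its domain, and the empty column is the empty map.
\<close>

type_synonym filling = "nat \<times> nat \<rightharpoonup> nat"
type_synonym column = "nat \<rightharpoonup> nat"

definition is_filling :: "filling \<Rightarrow> bool" where
  "is_filling T \<longleftrightarrow> diagram (dom T)"

definition num_columns :: "filling \<Rightarrow> nat" where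
  "num_columns T = Max (insert 0 (snd ` dom T))"

text \<open>
  The list of columns of a filling stops at its last nonempty column: empty columns to the left of
  it are listed, whereas trailing empty columns are invisible in a partial map.
  Conversely, \<open>of_columns\<close> accepts any list of columns, including trailing empty ones.
\<close>

definition columns :: "filling \<Rightarrow> column list" where
  "columns T = map (\<lambda>j i. T (i, j)) [1..<Suc (num_columns T)]"

definition of_columns :: "column list \<Rightarrow> filling" where
  "of_columns Cs = (\<lambda>(i, j). if 1 \<le> j \<and> j \<le> length Cs then (Cs ! (j - 1)) i else None)"

lemma of_columns_columns: "is_filling T \<Longrightarrow> of_columns (columns T) = T"
proof
  fix p :: "nat \<times> nat"
  assume T: "is_filling T"
  obtain i j where p: "p = (i, j)" by force
  show "of_columns (columns T) p = T p"
  proof (cases "T p")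
    case None
    then show ?thesis
      by (auto simp: p of_columns_def columns_def simp del: upt_Suc)
  next
    case (Some v)
    then have ij: "(i, j) \<in> dom T" by (simp add: p domI)
    then have "j \<in> snd ` dom T" by force
    moreover have "finite (dom T)" "1 \<le> j"
      using T ij by (auto simp: is_filling_def diagram_def)
    ultimately have "j \<le> num_columns T" by (simp add: num_columns_def)
    with \<open>1 \<le> j\<close> show ?thesis
      by (auto simp: p of_columns_def columns_def simp del: upt_Suc)
  qed
qed

text \<open>\<open>stretch [m\<^sub>1, \<dots>, m\<^sub>l] [C\<^sub>1, \<dots>, C\<^sub>l]\<close> is $(m_1 C_1, \dots, m_l C_l)$.\<close>

definition stretch :: "nat list \<Rightarrow> 'a list \<Rightarrow> 'a list" where
  "stretch ms Cs = concat (map2 replicate ms Cs)"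

definition multiplicities :: "nat \<Rightarrow> nat list set" where
  "multiplicities l = {ms. length ms = l \<and> (\<forall>m \<in> set ms. 1 \<le> m)}"

definition weakly_column_closed :: "filling set \<Rightarrow> bool" where
  "weakly_column_closed \<T> \<longleftrightarrow>
     (\<forall>Cs. \<forall>ms \<in> multiplicities (length Cs).
        of_columns Cs \<in> \<T> \<longleftrightarrow> of_columns (stretch ms Cs) \<in> \<T>)"

definition strictly_column_closed :: "filling set \<Rightarrow> bool" where
  "strictly_column_closed \<T> \<longleftrightarrow> weakly_column_closed \<T> \<and>
     (\<forall>Cs. of_columns Cs \<in> \<T> \<longrightarrow>
        (\<forall>j < length Cs. of_columns (take j Cs @ drop (Suc j) Cs) \<in> \<T>))"

definition left_of :: "filling \<Rightarrow> column \<Rightarrow> column \<Rightarrow> bool" where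
  "left_of T C C' \<longleftrightarrow>
     (\<exists>a b. a < b \<and> b < length (columns T) \<and> columns T ! a = C \<and> columns T ! b = C')"

definition well_behaved :: "filling set \<Rightarrow> bool" where
  "well_behaved \<T> \<longleftrightarrow> (\<forall>T \<in> \<T>.
     (\<forall>a b c. a < c \<and> c < b \<and> b < length (columns T) \<and> columns T ! a = columns T ! b
        \<longrightarrow> columns T ! c = columns T ! a) \<and>
     (\<forall>C\<^sub>1 C\<^sub>2. C\<^sub>1 \<noteq> C\<^sub>2 \<and> left_of T C\<^sub>1 C\<^sub>2 \<longrightarrow>
        (\<forall>T' \<in> \<T> - {T}. \<not> left_of T' C\<^sub>2 C\<^sub>1)))"

text \<open>
  Vectors in $\mathbf{N}^s$ are functions \<open>'s \<Rightarrow> nat\<close> on a finite index type. A statistic is a total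
  function on fillings, of which only the values on the family matter.
\<close>

definition affine_statistic :: "filling set \<Rightarrow> (filling \<Rightarrow> 's::finite \<Rightarrow> nat) \<Rightarrow> bool" where
  "affine_statistic \<T> \<sigma> \<longleftrightarrow> (\<forall>T \<in> \<T>. \<exists>A :: 's \<Rightarrow> nat. \<exists>S :: nat \<Rightarrow> 's \<Rightarrow> nat.
     \<forall>ms \<in> multiplicities (length (columns T)). \<forall>x.
       \<sigma> (of_columns (stretch ms (columns T))) x
         = A x + (\<Sum>j < length (columns T). ms ! j * S j x))"

definition linear_statistic ::
    "filling set \<Rightarrow> (filling \<Rightarrow> 's::finite \<Rightarrow> nat) \<Rightarrow> (column \<Rightarrow> 's \<Rightarrow> nat) \<Rightarrow> bool" where
  "linear_statistic \<T> \<sigma> val \<longleftrightarrow> (\<forall>T \<in> \<T>.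
     \<forall>ms \<in> multiplicities (length (columns T)). \<forall>x.
       \<sigma> (of_columns (stretch ms (columns T))) x
         = (\<Sum>j < length (columns T). ms ! j * val (columns T ! j) x))"

definition linear_extension :: "(column \<Rightarrow> 's::finite \<Rightarrow> nat) \<Rightarrow> filling \<Rightarrow> 's \<Rightarrow> nat" where
  "linear_extension val T = (\<lambda>x. \<Sum>j < length (columns T). val (columns T ! j) x)"

text \<open>Integer polynomials in the variables $z_x$, where $x$ ranges over the index type.\<close>

type_synonym 's zpoly = "('s \<Rightarrow>\<^sub>0 nat) \<Rightarrow>\<^sub>0 int"

definition z_var :: "'s \<Rightarrow> 's zpoly" where
  "z_var x = Poly_Mapping.single (Poly_Mapping.single x 1) 1"

definition z_pow :: "('s::finite \<Rightarrow> nat) \<Rightarrow> 's zpoly" where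
  "z_pow v = (\<Prod>x \<in> UNIV. z_var x ^ v x)"

definition fillings_of :: "filling set \<Rightarrow> (nat \<times> nat) set \<Rightarrow> nat \<Rightarrow> filling set" where
  "fillings_of \<T> D n = {T \<in> \<T>. dom T = D \<and> (\<forall>v \<in> ran T. 1 \<le> v \<and> v \<le> n)}"

definition H_poly ::
    "filling set \<Rightarrow> (filling \<Rightarrow> 's::finite \<Rightarrow> nat) \<Rightarrow> nat \<Rightarrow> (nat \<times> nat) set \<Rightarrow> 's zpoly" where
  "H_poly \<T> \<sigma> n D = (\<Sum>T \<in> fillings_of \<T> D n. z_pow (\<sigma> T))"

text \<open>
  For \<open>p = t^r + c\<^sub>1 t^(r-1) + \<dots> + c\<^sub>r\<close> the coefficient $c_i$ is \<open>coeff p (r - i)\<close>, with $c_0 = 1$.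
\<close>

definition satisfies_recurrence :: "nat \<Rightarrow> (nat \<Rightarrow> 'a::comm_ring_1) \<Rightarrow> 'a poly \<Rightarrow> bool" where
  "satisfies_recurrence k\<^sub>0 a p \<longleftrightarrow> lead_coeff p = 1 \<and>
     (\<forall>k \<ge> k\<^sub>0 + degree p. (\<Sum>i \<le> degree p. coeff p (degree p - i) * a (k - i)) = 0)"

definition root_fillings :: "filling set \<Rightarrow> (nat \<times> nat) set \<Rightarrow> nat \<Rightarrow> filling set" where
  "root_fillings \<T> D n = {T. dom T = D \<and>
     (\<forall>j. Suc j < length (columns T) \<and> dom (columns T ! j) = dom (columns T ! Suc j)
        \<longrightarrow> columns T ! j = columns T ! Suc j) \<and>
     (\<exists>k \<ge> 1. \<exists>U \<in> fillings_of \<T> (repeat_columns k D) n.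
        \<exists>Cs. subseq Cs (columns U) \<and> T = of_columns Cs)}"

end

theory Submission imports Defs begin

text \<open>
  By (i) of well-behavedness the equal columns of a filling in \<open>\<T>\<close> are contiguous, so an element
  of $\mathcal{T}(kD,n)$ is a compressed filling with distinct columns together with a positive multiplicity for each of them.
  Compressed fillings do not depend on \<open>k\<close> and there are finitely many of them. In a maximal block of
  \<open>p\<close> equal column shapes of \<open>D\<close> the multiplicities form a composition of \<open>k p\<close>, so each compressed
  filling contributes a monomial times a product over the blocks of sums of $x_1^{m_1} \cdots x_l^{m_l}$
  over $m_1 + \dots + m_l = k p$. As a sequence in \<open>k\<close> a block has the characteristic roots $x_i^p$, and
  a product of sequences has the products of the roots. If \<open>\<sigma>\<close> is linear, picking one column
  per block is picking a filling \<open>T\<close> of shape \<open>D\<close> of the required kind, and the product of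
  the roots is $\mathbf{z}^{\sigma(T)}$.
\<close>

subsection \<open>Sequences annihilated by a polynomial in the shift\<close>

text \<open>This is \<open>p(E)\<close> applied to \<open>a\<close> for the shift operator
  \<open>E\<close>, so that algebra of polynomials becomes algebra of commuting operators on
  sequences.\<close>

definition shift_act :: "'a::comm_ring_1 poly \<Rightarrow> (nat \<Rightarrow> 'a) \<Rightarrow> nat \<Rightarrow> 'a" where
  "shift_act p a k = (\<Sum>i\<le>degree p. coeff p i * a (k + i))"

definition annihilates :: "'a::comm_ring_1 poly \<Rightarrow> (nat \<Rightarrow> 'a) \<Rightarrow> bool" where
  "annihilates p a \<longleftrightarrow> (\<forall>k. shift_act p a k = 0)"

lemma shift_act_bound:
  assumes "degree p \<le> n"
  shows "shift_act p a k = (\<Sum>i\<le>n. coeff p i * a (k + i))"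
  unfolding shift_act_def using assms
  by (intro sum.mono_neutral_left) (auto simp: coeff_eq_0)

lemma shift_act_0: "shift_act 0 a k = 0"
  by (simp add: shift_act_def)

lemma shift_act_pCons: "shift_act (pCons c p) a k = c * a k + shift_act p a (Suc k)"
proof -
  have "shift_act (pCons c p) a k = (\<Sum>i\<le>Suc (degree p). coeff (pCons c p) i * a (k + i))"
    by (rule shift_act_bound) (simp add: degree_pCons_le)
  also have "\<dots> = c * a k + shift_act p a (Suc k)"
    by (subst sum.atMost_Suc_shift) (simp add: shift_act_def)
  finally show ?thesis .
qed

lemma shift_act_add_left: "shift_act (p + q) a k = shift_act p a k + shift_act q a k"
proof -
  let ?n = "max (degree p) (degree q)"
  have "degree (p + q) \<le> ?n"
    by (rule degree_add_le_max)
  then show ?thesis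
    by (simp add: shift_act_bound[where n = ?n] sum.distrib algebra_simps)
qed

lemma shift_act_smult: "shift_act (smult c p) a k = c * shift_act p a k"
proof -
  have "shift_act (smult c p) a k = (\<Sum>i\<le>degree p. coeff (smult c p) i * a (k + i))"
    by (rule shift_act_bound) (simp add: degree_smult_le)
  then show ?thesis
    by (simp add: shift_act_def sum_distrib_left mult.assoc)
qed

text \<open>\<open>pCons c p\<close> stands for \<open>c + t p\<close>, and \<open>t\<close> acts as
  the shift. Hence induction on \<open>p\<close> reduces the claim to additivity and scaling in the
  polynomial.\<close>

lemma shift_act_mult: "shift_act (p * q) a k = shift_act p (shift_act q a) k"
  by (induction p arbitrary: k)
    (simp_all add: shift_act_0 shift_act_pCons shift_act_add_left shift_act_smult)

lemma shift_act_add: "shift_act p (\<lambda>k. a k + b k) k = shift_act p a k + shift_act p b k"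
  by (simp add: shift_act_def sum.distrib algebra_simps)

lemma shift_act_zero: "shift_act p (\<lambda>k. 0) k = 0"
  by (simp add: shift_act_def)

lemma shift_act_scale: "shift_act p (\<lambda>k. c * a k) k = c * shift_act p a k"
  by (simp add: shift_act_def sum_distrib_left algebra_simps)

lemma annihilates_zero: "annihilates p (\<lambda>k. 0)"
  by (simp add: annihilates_def shift_act_zero)

lemma annihilates_add:
  "annihilates p a \<Longrightarrow> annihilates p b \<Longrightarrow> annihilates p (\<lambda>k. a k + b k)"
  by (simp add: annihilates_def shift_act_add)

lemma annihilates_scale: "annihilates p a \<Longrightarrow> annihilates p (\<lambda>k. c * a k)"
  by (simp add: annihilates_def shift_act_scale)

lemma annihilates_sum:
  "(\<And>i. i \<in> I \<Longrightarrow> annihilates p (a i)) \<Longrightarrow> annihilates p (\<lambda>k. \<Sum>i\<in>I. a i k)"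
  by (induction I rule: infinite_finite_induct) (auto intro: annihilates_add annihilates_zero)

lemma annihilates_Suc: "annihilates p a \<Longrightarrow> annihilates p (\<lambda>k. a (Suc k))"
  by (simp add: annihilates_def shift_act_def flip: add_Suc)

lemma annihilates_mult: "annihilates (p * q) a \<longleftrightarrow> annihilates p (shift_act q a)"
  by (simp add: annihilates_def shift_act_mult)

text \<open>The cofactor acts on the zero sequence. This allows sequences with different
  characteristic polynomials to be added: each is lifted to a common multiple.\<close>

lemma annihilates_dvd:
  assumes "annihilates q a" "q dvd p"
  shows "annihilates p a"
proof -
  from assms(2) obtain r where r: "p = r * q"
    by (metis dvdE mult.commute)
  have "shift_act q a = (\<lambda>k. 0)"
    using assms(1) by (auto simp: annihilates_def)
  then show ?thesis
    by (simp add: r annihilates_mult annihilates_zero)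
qed

lemma shift_act_linear: "shift_act [:- x, 1:] a = (\<lambda>k. a (Suc k) - x * a k)"
  by (auto simp: shift_act_pCons shift_act_0)

section \<open>Sequences with prescribed characteristic roots\<close>

text \<open>The roots form a list because repeated roots count with multiplicity.\<close>

definition poly_of_roots :: "'a::comm_ring_1 list \<Rightarrow> 'a poly" where
  "poly_of_roots xs = (\<Prod>x\<leftarrow>xs. [:- x, 1:])"

lemma poly_of_roots_simps [simp]:
  "poly_of_roots [] = 1"
  "poly_of_roots (x # xs) = [:- x, 1:] * poly_of_roots xs"
  "poly_of_roots (xs @ ys) = poly_of_roots xs * poly_of_roots ys"
  by (simp_all add: poly_of_roots_def)

lemma annihilates_poly_of_roots_Nil [simp]: "annihilates (poly_of_roots []) a \<longleftrightarrow> (\<forall>k. a k = 0)"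
  by (simp add: annihilates_def shift_act_def)

text \<open>The factors commute, so \<open>E - x\<close> may be applied first. This drives all
  inductions on the list of roots: one root less, at the price of a new sequence.\<close>

lemma annihilates_poly_of_roots_Cons:
  "annihilates (poly_of_roots (x # xs)) a
     \<longleftrightarrow> annihilates (poly_of_roots xs) (\<lambda>k. a (Suc k) - x * a k)"
  unfolding poly_of_roots_simps
  by (subst mult.commute) (simp only: annihilates_mult shift_act_linear)

definition pairwise_products :: "'a::comm_ring_1 list \<Rightarrow> 'a list \<Rightarrow> 'a list" where
  "pairwise_products xs ys = [x * y. x \<leftarrow> xs, y \<leftarrow> ys]"

lemma pairwise_products_Cons:
  "pairwise_products (x # xs) ys = map ((*) x) ys @ pairwise_products xs ys"
  by (simp add: pairwise_products_def)

text \<open>The products with \<open>y\<close> are scattered through the list, one in each row, so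
  they are removed row by row.\<close>

lemma poly_of_pairwise_products_dvd_Cons:
  "poly_of_roots (pairwise_products xs ys) dvd poly_of_roots (pairwise_products xs (y # ys))"
proof (induction xs)
  case (Cons x xs)
  show ?case
    unfolding pairwise_products_Cons list.map poly_of_roots_simps
    by (intro mult_dvd_mono dvd_mult Cons.IH) simp
qed (simp add: pairwise_products_def)

text \<open>
  With the shift \<open>E\<close>, the factor for the roots \<open>x\<close> and \<open>y\<close> acts by
  \<open>(E - x y)(a b) = ((E - x) a) (E b) + x a ((E - y) b)\<close>: each summand has lost a root of one factor.
\<close>

lemma annihilates_pairwise_products:
  assumes "annihilates (poly_of_roots xs) a" "annihilates (poly_of_roots ys) b"
  shows "annihilates (poly_of_roots (pairwise_products xs ys)) (\<lambda>k. a k * b k)"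
  using assms
proof (induction "length xs + length ys" arbitrary: xs ys a b rule: less_induct)
  case less
  show ?case
  proof (cases xs)
    case Nil
    then have "a = (\<lambda>k. 0)"
      using less.prems(1) by (auto simp del: poly_of_roots_simps)
    then show ?thesis
      by (simp add: annihilates_zero)
  next
    case x: (Cons x xs')
    show ?thesis
    proof (cases ys)
      case Nil
      then have "b = (\<lambda>k. 0)"
        using less.prems(2) by (auto simp del: poly_of_roots_simps)
      then show ?thesis
        by (simp add: annihilates_zero)
    next
      case y: (Cons y ys')
      let ?a' = "\<lambda>k. a (Suc k) - x * a k"
      let ?b' = "\<lambda>k. b (Suc k) - y * b k"
      \<comment> \<open>\<open>?F\<close> is the list of roots left after splitting off
        \<open>x * y\<close>. The first summand is annihilated by the rows of \<open>xs'\<close>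
        alone, the second by \<open>?F\<close> without the products of \<open>xs'\<close> with
        \<open>y\<close>; both polynomials divide that of \<open>?F\<close>.\<close>
      let ?F = "map ((*) x) ys' @ pairwise_products xs' ys"
      have pp: "pairwise_products xs ys = x * y # ?F"
        by (simp add: x y pairwise_products_Cons)
      have "annihilates (poly_of_roots (pairwise_products xs' ys)) (\<lambda>k. ?a' k * b (Suc k))"
        using less.prems
        by (intro less.hyps) (auto simp: x annihilates_poly_of_roots_Cons
            simp del: poly_of_roots_simps intro: annihilates_Suc)
      then have 1: "annihilates (poly_of_roots ?F) (\<lambda>k. ?a' k * b (Suc k))"
        by (rule annihilates_dvd) simp
      have "annihilates (poly_of_roots (pairwise_products xs ys')) (\<lambda>k. a k * ?b' k)"
        using less.prems
        by (intro less.hyps) (auto simp: y annihilates_poly_of_roots_Cons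
            simp del: poly_of_roots_simps)
      then have "annihilates (poly_of_roots ?F) (\<lambda>k. a k * ?b' k)"
        by (rule annihilates_dvd)
          (simp add: x y pairwise_products_Cons poly_of_pairwise_products_dvd_Cons mult_dvd_mono)
      then have 2: "annihilates (poly_of_roots ?F) (\<lambda>k. x * (a k * ?b' k))"
        by (rule annihilates_scale)
      have "(\<lambda>k. a (Suc k) * b (Suc k) - x * y * (a k * b k))
          = (\<lambda>k. ?a' k * b (Suc k) + x * (a k * ?b' k))"
        by (auto simp: algebra_simps)
      with annihilates_add[OF 1 2] show ?thesis
        by (simp only: pp annihilates_poly_of_roots_Cons)
    qed
  qed
qed

text \<open>Shifting the subsequence by one applies \<open>E^p\<close> to \<open>a\<close>, and
  \<open>E - x\<close> divides \<open>E^p - x^p\<close>. The offset \<open>r\<close> is general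
  because the quotient involves the shifts \<open>E^i\<close> with \<open>i < p\<close>.\<close>

lemma annihilates_subsequence:
  assumes "annihilates (poly_of_roots xs) a"
  shows "annihilates (poly_of_roots (map (\<lambda>x. x ^ p) xs)) (\<lambda>k. a (k * p + r))"
  using assms
proof (induction xs arbitrary: a r)
  case Nil
  then show ?case
    by (simp del: poly_of_roots_simps)
next
  case (Cons x xs)
  let ?a' = "\<lambda>k. a (Suc k) - x * a k"
  \<comment> \<open>The factorization of \<open>E^p - x^p\<close> as the sum of all
    \<open>x^(p-1-i) E^i\<close> times \<open>E - x\<close>.\<close>
  have tele: "a (m + p) - x ^ p * a m = (\<Sum>i<p. x ^ (p - Suc i) * ?a' (m + i))" for m
  proof (induction p)
    case (Suc p)
    have "(\<Sum>i<Suc p. x ^ (Suc p - Suc i) * ?a' (m + i))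
        = x * (\<Sum>i<p. x ^ (p - Suc i) * ?a' (m + i)) + ?a' (m + p)"
      by (auto simp: sum_distrib_left Suc_diff_Suc mult.assoc[symmetric] power_Suc[symmetric]
          simp del: power_Suc intro!: sum.cong)
    also have "\<dots> = a (m + Suc p) - x ^ Suc p * a m"
      unfolding Suc.IH[symmetric] by (simp add: algebra_simps)
    finally show ?case
      by simp
  qed simp
  have "annihilates (poly_of_roots (map (\<lambda>x. x ^ p) xs)) (\<lambda>k. ?a' (k * p + (r + i)))" for i
    using Cons.prems by (intro Cons.IH) (simp only: annihilates_poly_of_roots_Cons)
  then have "annihilates (poly_of_roots (map (\<lambda>x. x ^ p) xs))
      (\<lambda>k. \<Sum>i<p. x ^ (p - Suc i) * ?a' (k * p + (r + i)))"
    by (rule annihilates_sum[OF annihilates_scale])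
  moreover have "(\<lambda>k. \<Sum>i<p. x ^ (p - Suc i) * ?a' (k * p + (r + i)))
      = (\<lambda>k. a (Suc k * p + r) - x ^ p * a (k * p + r))"
    by (rule ext, subst mult_Suc, subst add.commute[of p], subst add.assoc, subst add.commute[of p],
        subst add.assoc[symmetric], subst tele) (simp add: add.assoc)
  ultimately show ?case
    by (simp only: list.map annihilates_poly_of_roots_Cons)
qed

section \<open>Sums over compositions\<close>

text \<open>
  The sum of $x_1^{m_1} \cdots x_l^{m_l}$ over all compositions $m_1 + \dots + m_l = N$ into positive
  parts. The recursion distinguishes whether $m_1 > 1$ or $m_1 = 1$.
\<close>

fun composition_sum :: "'a::comm_ring_1 list \<Rightarrow> nat \<Rightarrow> 'a" where
  "composition_sum [] N = of_bool (N = 0)"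
| "composition_sum (x # xs) 0 = 0"
| "composition_sum (x # xs) (Suc N) = x * (composition_sum (x # xs) N + composition_sum xs N)"

text \<open>Without the shift by one the recurrence fails, because of the empty composition of 0.\<close>

lemma annihilates_composition_sum:
  "xs \<noteq> [] \<Longrightarrow> annihilates (poly_of_roots xs) (\<lambda>N. composition_sum xs (Suc N))"
proof (induction xs)
  case (Cons x xs)
  have eq: "(\<lambda>N. composition_sum (x # xs) (Suc (Suc N)) - x * composition_sum (x # xs) (Suc N))
      = (\<lambda>N. x * composition_sum xs (Suc N))"
    by (auto simp: algebra_simps)
  have "annihilates (poly_of_roots xs) (\<lambda>N. x * composition_sum xs (Suc N))"
  proof (cases "xs = []")
    case False
    then show ?thesis
      by (intro annihilates_scale Cons.IH)
  qed (simp del: poly_of_roots_simps)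
  then show ?case
    by (simp only: annihilates_poly_of_roots_Cons eq)
qed simp

definition compositions :: "nat \<Rightarrow> nat \<Rightarrow> nat list set" where
  "compositions l N = {ms \<in> multiplicities l. sum_list ms = N}"

lemma finite_compositions: "finite (compositions l N)"
proof (rule finite_subset)
  show "compositions l N \<subseteq> {ms. set ms \<subseteq> {..N} \<and> length ms = l}"
    by (auto simp: compositions_def multiplicities_def intro: member_le_sum_list)
  show "finite {ms. set ms \<subseteq> {..N} \<and> length ms = l}"
    by (rule finite_lists_length_eq) simp
qed

lemma compositions_0: "compositions 0 N = (if N = 0 then {[]} else {})"
  by (auto simp: compositions_def multiplicities_def)

lemma compositions_Suc_0: "compositions (Suc l) 0 = {}"
  by (auto simp: compositions_def multiplicities_def length_Suc_conv)

text \<open>The set-level counterpart of the recursion of \<open>composition_sum\<close>: the image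
  collects the compositions with first part above 1, the other set those with first part 1.\<close>

lemma compositions_Suc_Suc:
  "compositions (Suc l) (Suc N) =
     (\<lambda>ms. Suc (hd ms) # tl ms) ` compositions (Suc l) N \<union> (#) 1 ` compositions l N"
  (is "?L = ?R")
proof
  show "?R \<subseteq> ?L"
    by (auto simp: compositions_def multiplicities_def length_Suc_conv)
  show "?L \<subseteq> ?R"
  proof
    fix ms assume ms: "ms \<in> ?L"
    then obtain m ns where m: "ms = m # ns"
      by (auto simp: compositions_def multiplicities_def length_Suc_conv)
    show "ms \<in> ?R"
    proof (cases "m = 1")
      case True
      then show ?thesis
        using ms m by (auto simp: compositions_def multiplicities_def)
    next
      case False
      then have "(m - 1) # ns \<in> compositions (Suc l) N" "ms = Suc (m - 1) # ns"
        using ms m by (auto simp: compositions_def multiplicities_def)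
      then show ?thesis
        by (intro UnI1 rev_image_eqI[of "(m - 1) # ns"]) auto
    qed
  qed
qed

lemma sum_compositions:
  "(\<Sum>ms\<in>compositions (length xs) N. prod_list (map2 (^) xs ms)) = composition_sum xs N"
proof (induction xs N rule: composition_sum.induct)
  case (3 x xs N)
  let ?f = "\<lambda>ms. Suc (hd ms) # tl ms" and ?C = "compositions (Suc (length xs)) N"
  have ne: "ms \<noteq> []" if "ms \<in> ?C" for ms
    using that by (auto simp: compositions_def multiplicities_def)
  have inj: "inj_on ?f ?C"
    by (rule inj_onI) (metis ne list.expand list.sel Suc_inject)
  \<comment> \<open>Parts are positive, so a raised first part is at least 2.\<close>
  have disj: "?f ` ?C \<inter> (#) 1 ` compositions (length xs) N = {}"
    using ne by (force simp: compositions_def multiplicities_def neq_Nil_conv)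
  have "(\<Sum>ms\<in>compositions (length (x # xs)) (Suc N). prod_list (map2 (^) (x # xs) ms))
      = (\<Sum>ms\<in>?C. prod_list (map2 (^) (x # xs) (?f ms)))
        + (\<Sum>ms\<in>compositions (length xs) N. prod_list (map2 (^) (x # xs) (1 # ms)))"
    unfolding list.size add_Suc_right add_0_right compositions_Suc_Suc
    by (subst sum.union_disjoint[OF _ _ disj])
      (auto simp: finite_compositions sum.reindex[OF inj] sum.reindex o_def)
  also have "(\<Sum>ms\<in>?C. prod_list (map2 (^) (x # xs) (?f ms)))
      = x * (\<Sum>ms\<in>?C. prod_list (map2 (^) (x # xs) ms))"
    unfolding sum_distrib_left
  proof (rule sum.cong)
    fix ms assume "ms \<in> ?C"
    with ne obtain m ns where "ms = m # ns"
      by (meson neq_Nil_conv)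
    then show "prod_list (map2 (^) (x # xs) (?f ms)) = x * prod_list (map2 (^) (x # xs) ms)"
      by (simp add: mult.assoc)
  qed simp
  also have "(\<Sum>ms\<in>compositions (length xs) N. prod_list (map2 (^) (x # xs) (1 # ms)))
      = x * (\<Sum>ms\<in>compositions (length xs) N. prod_list (map2 (^) xs ms))"
    by (simp add: sum_distrib_left)
  finally show ?case
    using 3 by (simp add: algebra_simps)
qed (simp_all add: compositions_0 compositions_Suc_0)

section \<open>Monic polynomials and recurrences\<close>

text \<open>In an arbitrary commutative ring degrees need not add up under multiplication. Here they
  do, since the coefficient at the sum of the degrees is 1 and hence nonzero.\<close>

lemma lead_coeff_monic_mult:
  fixes p q :: "'a::comm_ring_1 poly"
  assumes "lead_coeff p = 1" "lead_coeff q = 1"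
  shows "lead_coeff (p * q) = 1"
proof -
  have "coeff (p * q) (degree p + degree q) = 1"
    using assms by (simp add: coeff_mult_degree_sum)
  moreover from this have "degree (p * q) = degree p + degree q"
    by (metis degree_mult_le le_antisym le_degree zero_neq_one)
  ultimately show ?thesis
    by simp
qed

lemma lead_coeff_monic_prod:
  fixes p :: "'b \<Rightarrow> 'a::comm_ring_1 poly"
  shows "(\<And>i. i \<in> I \<Longrightarrow> lead_coeff (p i) = 1) \<Longrightarrow> lead_coeff (\<Prod>i\<in>I. p i) = 1"
  by (induction I rule: infinite_finite_induct) (auto intro: lead_coeff_monic_mult)

lemma lead_coeff_poly_of_roots: "lead_coeff (poly_of_roots xs) = 1"
  by (induction xs)
    (auto simp only: poly_of_roots_simps lead_coeff_1 intro!: lead_coeff_monic_mult, simp)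

text \<open>A recurrence lists the coefficients from the top, \<open>shift_act\<close> from the
  bottom; reflecting the summation index translates. The \<open>Suc\<close> makes index 0 of the
  annihilated sequence the first term \<open>a 1\<close>.\<close>

lemma satisfies_recurrence_1I:
  assumes "lead_coeff p = 1" "annihilates p (\<lambda>k. a (Suc k))"
  shows "satisfies_recurrence 1 a p"
  unfolding satisfies_recurrence_def
proof (intro conjI allI impI)
  fix k assume k: "1 + degree p \<le> k"
  have "(\<Sum>i\<le>degree p. coeff p (degree p - i) * a (k - i))
      = (\<Sum>i\<le>degree p. coeff p i * a (Suc (k - Suc (degree p) + i)))"
    using k by (intro sum.reindex_bij_witness[of _ "\<lambda>i. degree p - i" "\<lambda>i. degree p - i"])
      (auto simp: Suc_diff_Suc Suc_diff_le)
  also have "\<dots> = 0"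
    using assms(2) by (simp add: annihilates_def shift_act_def)
  finally show "(\<Sum>i\<le>degree p. coeff p (degree p - i) * a (k - i)) = 0" .
qed fact

subsection \<open>Run-length encoding and blocks\<close>

lemma stretch_simps [simp]:
  "stretch [] xs = []"
  "stretch ms [] = []"
  "stretch (m # ms) (x # xs) = replicate m x @ stretch ms xs"
  by (simp_all add: stretch_def)

lemma multiplicities_simps [simp]:
  "ms \<in> multiplicities 0 \<longleftrightarrow> ms = []"
  "m # ms \<in> multiplicities (Suc l) \<longleftrightarrow> 1 \<le> m \<and> ms \<in> multiplicities l"
  by (auto simp: multiplicities_def)

lemma length_multiplicities: "ms \<in> multiplicities l \<Longrightarrow> length ms = l"
  by (simp add: multiplicities_def)

lemma multiplicities_induct [consumes 1, case_names Nil Cons]: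
  assumes "ms \<in> multiplicities (length xs)"
    and "P [] []"
    and "\<And>m ms x xs. \<lbrakk>1 \<le> m; ms \<in> multiplicities (length xs); P ms xs\<rbrakk> \<Longrightarrow> P (m # ms) (x # xs)"
  shows "P ms xs"
proof -
  from assms(1) have "length ms = length xs"
    by (rule length_multiplicities)
  from this assms(1) show ?thesis
    by (induction ms xs rule: list_induct2) (auto intro: assms(2,3))
qed

lemma map_stretch: "map f (stretch ms xs) = stretch ms (map f xs)"
  by (induction ms xs rule: list_induct2') auto

lemma set_stretch: "ms \<in> multiplicities (length xs) \<Longrightarrow> set (stretch ms xs) = set xs"
  by (induction rule: multiplicities_induct) auto

lemma last_stretch: "ms \<in> multiplicities (length xs) \<Longrightarrow> last (stretch ms xs) = last xs"
proof (induction rule: multiplicities_induct)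
  case (Cons m ms x xs)
  then have "stretch ms xs = [] \<longleftrightarrow> xs = []"
    using set_stretch by (metis set_empty)
  with Cons show ?case
    by simp
qed simp

lemma length_stretch: "length ms = length xs \<Longrightarrow> length (stretch ms xs) = sum_list ms"
  by (induction ms xs rule: list_induct2) auto

lemma stretch_append:
  "length ms = length xs \<Longrightarrow> stretch (ms @ ms') (xs @ xs') = stretch ms xs @ stretch ms' xs'"
  by (simp add: stretch_def)

lemma concat_map_replicate_stretch:
  "concat (map (replicate k) (stretch ms xs)) = stretch (map ((*) k) ms) xs"
proof -
  have "concat (map (replicate k) (replicate m x)) = replicate (k * m) x" for m and x :: 'a
    by (induction m) (auto simp: replicate_add)
  then show ?thesis
    by (induction ms xs rule: list_induct2') auto
qed

lemma nth_concat_map_replicate: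
  "q < k * length xs \<Longrightarrow> concat (map (replicate k) xs) ! q = xs ! (q div k)"
proof (induction xs arbitrary: q)
  case (Cons x xs)
  show ?case
  proof (cases "q < k")
    case False
    then have "q div k = Suc ((q - k) div k)"
      using Cons.prems by (cases "k = 0") (auto simp: le_div_geq)
    with False Cons show ?thesis
      by (auto simp: nth_append)
  qed (simp add: nth_append)
qed simp

lemma ex_stretch_remdups_adj:
  "\<exists>ms \<in> multiplicities (length (remdups_adj xs)). xs = stretch ms (remdups_adj xs)"
proof (induction xs rule: remdups_adj.induct)
  case (3 x y xs)
  show ?case
  proof (cases "x = y")
    case True
    obtain zs where zs: "remdups_adj (x # xs) = x # zs"
      by (metis remdups_adj_Cons_alt)
    with "3.IH"(1)[OF True] obtain m ms where
      "m # ms \<in> multiplicities (length (x # zs))" "x # xs = stretch (m # ms) (x # zs)"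
      by (auto simp: multiplicities_def length_Suc_conv)
    then have "Suc m # ms \<in> multiplicities (length (x # zs))"
      "x # x # xs = stretch (Suc m # ms) (x # zs)"
      by auto
    with zs True show ?thesis
      by (metis remdups_adj.simps(3))
  next
    case False
    with "3.IH"(2) obtain ms where
      "ms \<in> multiplicities (length (remdups_adj (y # xs)))"
      "y # xs = stretch ms (remdups_adj (y # xs))"
      by blast
    with False show ?thesis
      by (intro bexI[of _ "1 # ms"]) auto
  qed
qed (auto intro: bexI[of _ "[1]"])

lemma remdups_stretch:
  "ms \<in> multiplicities (length xs) \<Longrightarrow> distinct xs \<Longrightarrow> remdups (stretch ms xs) = xs"
proof (induction rule: multiplicities_induct)
  case (Cons m ms x xs)
  then have "x \<notin> set (stretch ms xs)"
    by (simp add: set_stretch)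
  then have "remdups (replicate (Suc j) x @ stretch ms xs) = x # remdups (stretch ms xs)" for j
    by (induction j) auto
  from this[of "m - 1"] Cons show ?case
    by simp
qed simp

lemma count_list_stretch:
  "ms \<in> multiplicities (length xs) \<Longrightarrow> distinct xs \<Longrightarrow> map (count_list (stretch ms xs)) xs = ms"
proof (induction rule: multiplicities_induct)
  case (Cons m ms x xs)
  have "count_list (replicate m x) y = (if y = x then m else 0)" for y
    by (induction m) auto
  moreover from Cons have "x \<notin> set (stretch ms xs)"
    by (simp add: set_stretch)
  ultimately have "map (count_list (stretch (m # ms) (x # xs))) xs = map (count_list (stretch ms xs)) xs"
    "count_list (stretch (m # ms) (x # xs)) x = m"
    using Cons.prems by (auto simp: count_list_0_iff)
  moreover have "map (count_list (stretch ms xs)) xs = ms"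
    using Cons by simp
  ultimately show ?case
    by (simp only: list.map)
qed simp

text \<open>\<open>remdups\<close> recovers the letters and counting recovers the multiplicities.
  Without distinctness this fails: \<open>stretch [1,1] [x,x] = stretch [2] [x]\<close>.\<close>

lemma stretch_inject:
  assumes "ms \<in> multiplicities (length xs)" "ms' \<in> multiplicities (length xs')"
    and "distinct xs" "distinct xs'" "stretch ms xs = stretch ms' xs'"
  shows "ms = ms' \<and> xs = xs'"
  using assms remdups_stretch count_list_stretch by metis

text \<open>With the multiplicities fixed, the runs of both lists sit at the same positions, and
  each run is nonempty and shows its letter. Thus different choices of one column per block give
  different lists of columns.\<close>

lemma inj_on_stretch:
  assumes "ms \<in> multiplicities l"
  shows "inj_on (stretch ms) {xs. length xs = l}"
proof -
  have "xs = ys"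
    if "ms \<in> multiplicities (length xs)" "length ys = length xs" "stretch ms xs = stretch ms ys"
    for xs ys :: "'a list"
    using that
  proof (induction arbitrary: ys rule: multiplicities_induct)
    case (Cons m ms x xs)
    then obtain y ys' where "ys = y # ys'"
      by (metis length_Suc_conv list.size(4) Suc_eq_plus1)
    with Cons show ?case
      by (auto simp: Suc_le_eq)
  qed simp
  with assms show ?thesis
    by (auto intro!: inj_onI)
qed

text \<open>Neighbours inside a run are equal, and where two runs meet the values of
  \<open>f\<close> differ. With \<open>f = dom\<close> this is the condition on adjacent columns in
  \<open>root_fillings\<close>.\<close>

lemma successively_stretch:
  assumes "ms \<in> multiplicities (length xs)" "distinct_adj (map f xs)"
  shows "successively (\<lambda>x y. f x = f y \<longrightarrow> x = y) (stretch ms xs)"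
  using assms
proof (induction rule: multiplicities_induct)
  case (Cons m ms x xs)
  let ?P = "\<lambda>x y. f x = f y \<longrightarrow> x = y"
  have "stretch ms xs = [] \<or> f (hd (stretch ms xs)) = hd (map f xs) \<and> xs \<noteq> []"
    using Cons.hyps by (cases ms; cases xs) (auto simp: multiplicities_def Suc_le_eq)
  moreover have "successively ?P (replicate m x)"
    by (simp add: successively_conv_nth)
  ultimately show ?case
    using Cons by (auto simp: successively_append_iff distinct_adj_Cons last_replicate)
qed simp

section \<open>Choosing one element from each of several sets\<close>

lemma listset_conv: "xs \<in> listset As \<longleftrightarrow> list_all2 (\<in>) xs As"
  by (induction As arbitrary: xs) (auto simp: set_Cons_def list_all2_Cons2)

lemma set_Cons_conv: "set_Cons A X = (\<lambda>(x, xs). x # xs) ` (A \<times> X)"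
  by (auto simp: set_Cons_def)

lemma finite_listset: "(\<And>A. A \<in> set As \<Longrightarrow> finite A) \<Longrightarrow> finite (listset As)"
  by (induction As) (auto simp: set_Cons_conv)

text \<open>The distributive law. It turns the sum over all multiplicities of a compressed filling
  into a product over its blocks.\<close>

lemma sum_listset_prod_list:
  fixes f :: "'a \<Rightarrow> 'b \<Rightarrow> 'c::comm_ring_1"
  shows "length xs = length As \<Longrightarrow>
    (\<Sum>ys\<in>listset As. prod_list (map2 f xs ys)) = prod_list (map2 (\<lambda>x A. \<Sum>y\<in>A. f x y) xs As)"
proof (induction xs As rule: list_induct2)
  case (Cons x xs A As)
  have inj: "inj_on (\<lambda>(y, ys). y # ys) (A \<times> listset As)"
    by (auto intro: inj_onI)
  have "(\<Sum>ys\<in>listset (A # As). prod_list (map2 f (x # xs) ys))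
      = (\<Sum>(y, ys)\<in>A \<times> listset As. f x y * prod_list (map2 f xs ys))"
    by (subst (2) split_def, simp add: set_Cons_conv sum.reindex[OF inj])
      (simp add: split_def)
  also have "\<dots> = (\<Sum>y\<in>A. f x y) * (\<Sum>ys\<in>listset As. prod_list (map2 f xs ys))"
    by (simp add: sum_product sum.cartesian_product)
  finally show ?case
    by (simp add: Cons)
qed simp

text \<open>Used to group the monomials of an affine statistic by blocks.\<close>

lemma ex_concat_map_length:
  "length xs = sum_list ls \<Longrightarrow> \<exists>xss. concat xss = xs \<and> map length xss = ls"
proof (induction ls arbitrary: xs)
  case (Cons l ls)
  then obtain xss where "concat xss = drop l xs" "map length xss = ls"
    by (metis add_diff_cancel_left' length_drop sum_list.Cons)
  with Cons.prems show ?case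
    by (intro exI[of _ "take l xs # xss"]) auto
qed simp

lemma product_lists_map: "product_lists (map (map f) xss) = map (map f) (product_lists xss)"
  by (induction xss) (auto simp: map_concat o_def)

text \<open>A block of width \<open>p\<close> contributes every \<open>p\<close>-th term of a
  composition sum, hence the roots \<open>x^p\<close>. Products of roots over the blocks correspond
  to choices of one \<open>x\<close> per block, each repeated \<open>p\<close> times.\<close>

lemma annihilates_prod_composition_sum:
  fixes xss :: "'a::comm_ring_1 list list"
  assumes "ps \<in> multiplicities (length xss)" "[] \<notin> set xss"
  shows "annihilates (poly_of_roots (map (prod_list \<circ> stretch ps) (product_lists xss)))
    (\<lambda>k. prod_list (map2 (\<lambda>xs p. composition_sum xs (Suc k * p)) xss ps))"
  using assms
proof (induction rule: multiplicities_induct)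
  \<comment> \<open>\<open>product_lists []\<close> is \<open>[[]]\<close>, so there is the single
    root 1, and the empty product is the constant sequence 1.\<close>
  case Nil
  show ?case
    by (simp add: annihilates_poly_of_roots_Cons annihilates_zero del: poly_of_roots_simps)
next
  case (Cons p ps xs xss)
  let ?roots = "map (prod_list \<circ> stretch ps) (product_lists xss)"
  \<comment> \<open>The recurrence holds for composition sums from total 1 on, hence the outer
    \<open>Suc\<close>; the offset \<open>p - 1\<close> then makes the totals the multiples
    \<open>Suc k * p\<close>.\<close>
  have "annihilates (poly_of_roots (map (\<lambda>x. x ^ p) xs))
      (\<lambda>k. composition_sum xs (Suc (k * p + (p - 1))))"
    using Cons.prems by (intro annihilates_subsequence[OF annihilates_composition_sum]) auto
  moreover have "Suc (k * p + (p - 1)) = Suc k * p" for k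
    using Cons.hyps by simp
  ultimately have "annihilates (poly_of_roots (map (\<lambda>x. x ^ p) xs))
      (\<lambda>k. composition_sum xs (Suc k * p))"
    by (simp only:)
  from annihilates_pairwise_products[OF this Cons.IH]
  have "annihilates (poly_of_roots (pairwise_products (map (\<lambda>x. x ^ p) xs) ?roots))
      (\<lambda>k. prod_list (map2 (\<lambda>xs p. composition_sum xs (Suc k * p)) (xs # xss) (p # ps)))"
    using Cons.prems by (simp del: mult_Suc add: o_def)
  moreover have "pairwise_products (map (\<lambda>x. x ^ p) xs) ?roots
      = map (prod_list \<circ> stretch (p # ps)) (product_lists (xs # xss))"
    by (simp add: pairwise_products_def map_concat o_def prod_list_replicate)
  ultimately show ?case
    by (simp only:)
qed

section \<open>Multiplicities arranged by blocks\<close>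

text \<open>The lists are nested because the total is prescribed for each block separately.\<close>

definition block_multiplicities :: "'a list list \<Rightarrow> nat list \<Rightarrow> nat list list set" where
  "block_multiplicities css Ns = listset (map2 (\<lambda>cs N. compositions (length cs) N) css Ns)"

lemma block_multiplicities_simps [simp]:
  "block_multiplicities [] Ns = {[]}"
  "block_multiplicities css [] = {[]}"
  "block_multiplicities (cs # css) (N # Ns)
     = set_Cons (compositions (length cs) N) (block_multiplicities css Ns)"
  by (simp_all add: block_multiplicities_def)

lemma finite_block_multiplicities: "finite (block_multiplicities css Ns)"
  by (auto simp: block_multiplicities_def intro!: finite_listset finite_compositions)

lemma compositions_multiplicities: "ms \<in> compositions l N \<Longrightarrow> ms \<in> multiplicities l"
  by (simp add: compositions_def)

text \<open>Column closure and the affine formula speak of flat lists of multiplicities; this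
  connects them with the nested ones.\<close>

lemma concat_block_multiplicities:
  "length css = length Ns \<Longrightarrow> mss \<in> block_multiplicities css Ns \<Longrightarrow>
     concat mss \<in> multiplicities (length (concat css)) \<and>
     concat (map2 stretch mss css) = stretch (concat mss) (concat css)"
proof (induction css Ns arbitrary: mss rule: list_induct2)
  case (Cons cs css N Ns)
  then show ?case
    by (auto simp: set_Cons_def compositions_def multiplicities_def stretch_append)
qed simp

lemma map_block_stretch:
  assumes "list_all2 (\<lambda>cs e. f ` set cs = {e}) css es" "length Ns = length es"
    and "mss \<in> block_multiplicities css Ns"
  shows "map f (concat (map2 stretch mss css)) = stretch Ns es"
  using assms(2,1,3)
proof (induction Ns es arbitrary: css mss rule: list_induct2)
  case (Cons N Ns e es)
  then obtain cs css' ms mss' where *: "css = cs # css'" "mss = ms # mss'" "f ` set cs = {e}"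
    "list_all2 (\<lambda>cs e. f ` set cs = {e}) css' es"
    "ms \<in> compositions (length cs) N" "mss' \<in> block_multiplicities css' Ns"
    by (auto simp: list_all2_Cons2 set_Cons_def)
  have "set (map f (stretch ms cs)) \<subseteq> {e}"
    using * by (auto simp: set_stretch compositions_multiplicities)
  moreover have "length (stretch ms cs) = N"
    using * by (simp add: compositions_def multiplicities_def length_stretch)
  ultimately have "map f (stretch ms cs) = replicate N e"
    by (intro replicate_eqI) auto
  with * Cons.IH show ?case
    by simp
qed simp

lemma map_concat_blocks:
  assumes "list_all2 (\<lambda>cs e. f ` set cs = {e}) css es"
  shows "map f (concat css) = stretch (map length css) es \<and>
    map length css \<in> multiplicities (length es)"
  using assms
proof (induction rule: list_all2_induct)
  case (Cons cs css e es)
  then have "map f cs = replicate (length cs) e"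
    by (intro replicate_eqI) auto
  with Cons show ?case
    by (auto simp: Suc_le_eq)
qed simp

text \<open>Cut \<open>us\<close> at the positions given by \<open>Ns\<close> and run-length encode
  each piece. This yields only \<open>distinct_adj\<close> blocks; full distinctness comes later
  from well-behavedness.\<close>

lemma ex_blocks:
  assumes "Ns \<in> multiplicities (length es)" "map f us = stretch Ns es"
  shows "\<exists>css mss. list_all2 (\<lambda>cs e. f ` set cs = {e}) css es \<and> (\<forall>cs\<in>set css. distinct_adj cs) \<and>
    mss \<in> block_multiplicities css Ns \<and> us = concat (map2 stretch mss css)"
  using assms
proof (induction arbitrary: us rule: multiplicities_induct)
  case (Cons N Ns e es)
  then obtain vs ws where us: "us = vs @ ws" "map f vs = replicate N e" "map f ws = stretch Ns es"
    by (auto simp: map_eq_append_conv)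
  from Cons.IH[OF us(3)] obtain css mss where IH:
    "list_all2 (\<lambda>cs e. f ` set cs = {e}) css es" "\<forall>cs\<in>set css. distinct_adj cs"
    "mss \<in> block_multiplicities css Ns" "ws = concat (map2 stretch mss css)"
    by blast
  obtain ms where ms: "ms \<in> multiplicities (length (remdups_adj vs))"
    "vs = stretch ms (remdups_adj vs)"
    using ex_stretch_remdups_adj by blast
  have "length vs = N"
    using us(2) by (metis length_map length_replicate)
  then have "ms \<in> compositions (length (remdups_adj vs)) N"
    using ms by (simp add: compositions_def) (metis length_multiplicities length_stretch)
  moreover have "f ` set (remdups_adj vs) = {e}"
    using arg_cong[OF us(2), of set] Cons.hyps by simp
  ultimately show ?case
    using IH us(1) ms(2)
    by (intro exI[of _ "remdups_adj vs # css"] exI[of _ "ms # mss"]) (auto simp: set_Cons_def)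
qed simp

text \<open>The totals \<open>Ns\<close> fix the length of every stretched block, so both
  concatenations are cut at the same positions, and \<open>stretch_inject\<close> applies to each
  block.\<close>

lemma blocks_inject:
  assumes "length css = length Ns" "length css' = length Ns"
    and "mss \<in> block_multiplicities css Ns" "mss' \<in> block_multiplicities css' Ns"
    and "\<forall>cs\<in>set css. distinct cs" "\<forall>cs\<in>set css'. distinct cs"
    and "concat (map2 stretch mss css) = concat (map2 stretch mss' css')"
  shows "css = css' \<and> mss = mss'"
  using assms
proof (induction css Ns arbitrary: css' mss mss' rule: list_induct2)
  case (Cons cs css N Ns)
  from Cons.prems obtain cs' dss where css': "css' = cs' # dss"
    by (metis length_Suc_conv)
  from Cons.prems obtain ms ns ms' ns' where mss: "mss = ms # ns" "mss' = ms' # ns'"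
    "ms \<in> compositions (length cs) N" "ms' \<in> compositions (length cs') N"
    "ns \<in> block_multiplicities css Ns" "ns' \<in> block_multiplicities dss Ns"
    by (auto simp: set_Cons_def css')
  have "length (stretch ms cs) = N" "length (stretch ms' cs') = N"
    using mss by (simp_all add: compositions_def multiplicities_def length_stretch)
  with Cons.prems(6) have "stretch ms cs = stretch ms' cs'"
    "concat (map2 stretch ns css) = concat (map2 stretch ns' dss)"
    by (auto simp: css' mss(1,2))
  with Cons mss stretch_inject[of ms cs ms' cs'] show ?case
    by (auto simp: css' compositions_multiplicities)
qed simp

text \<open>All other letters get multiplicity 1 and \<open>y\<close> gets the rest. At least
  \<open>p\<close> copies remain for \<open>y\<close>, because the others number at most
  \<open>K\<close>, which is at most \<open>K * p\<close>.\<close>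

lemma ex_subseq_stretch:
  assumes "y \<in> set cs" "1 \<le> p" "length cs \<le> K"
  shows "\<exists>ms\<in>compositions (length cs) (Suc K * p). subseq (replicate p y) (stretch ms cs)"
proof -
  obtain as bs where cs: "cs = as @ y # bs"
    using assms(1) by (auto simp: in_set_conv_decomp)
  have "length as + length bs \<le> K"
    using assms(3) by (simp add: cs)
  also have "K \<le> K * p"
    using assms(2) by simp
  finally obtain r where "K * p = length as + length bs + r"
    by (metis le_Suc_ex)
  then have r: "Suc K * p = length as + (p + r) + length bs"
    by simp
  \<comment> \<open>\<open>r\<close> is the slack left over after \<open>p\<close> copies of
    \<open>y\<close> and one copy of each other letter.\<close>
  let ?ms = "replicate (length as) 1 @ (p + r) # replicate (length bs) 1"
  have "?ms \<in> compositions (length cs) (Suc K * p)"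
    unfolding r using assms(2)
    by (auto simp: cs compositions_def multiplicities_def sum_list_replicate)
  moreover have "subseq (replicate p y) (stretch ?ms cs)"
    by (simp add: cs stretch_append replicate_add)
      (rule subseq_drop_many, rule subseq_rev_drop_many, rule subseq_order.refl)
  ultimately show ?thesis
    by blast
qed

text \<open>One factor \<open>Suc K\<close> serves all blocks at once. This realizes a choice of one
  column per block by deleting columns from a single filling of shape \<open>kD\<close>.\<close>

lemma ex_subseq_blocks:
  assumes "list_all2 (\<lambda>y cs. y \<in> set cs) ys css" "ps \<in> multiplicities (length ys)"
    and "\<forall>cs\<in>set css. length cs \<le> K"
  shows "\<exists>mss\<in>block_multiplicities css (map ((*) (Suc K)) ps).
    subseq (stretch ps ys) (concat (map2 stretch mss css))"
  using assms(2,1,3)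
proof (induction arbitrary: css rule: multiplicities_induct)
  case (Cons p ps y ys)
  then obtain cs css' where css: "css = cs # css'" "y \<in> set cs"
    "list_all2 (\<lambda>y cs. y \<in> set cs) ys css'"
    by (auto simp: list_all2_Cons1)
  with Cons obtain mss where mss: "mss \<in> block_multiplicities css' (map ((*) (Suc K)) ps)"
    "subseq (stretch ps ys) (concat (map2 stretch mss css'))"
    by fastforce
  obtain ms where ms: "ms \<in> compositions (length cs) (Suc K * p)"
    "subseq (replicate p y) (stretch ms cs)"
    using ex_subseq_stretch css Cons by (metis list.set_intros(1))
  from mss ms show ?case
    unfolding css(1)
    by (intro bexI[of _ "ms # mss"]) (auto simp: set_Cons_def simp del: mult_Suc intro: list_emb_append_mono)
qed simp

text \<open>If positions \<open>a < b\<close> carry equal entries, then position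
  \<open>Suc a\<close> carries the same entry, by contiguity or because it is \<open>b\<close>,
  against \<open>distinct_adj\<close>.\<close>

lemma distinct_if_contiguous:
  assumes "distinct_adj xs"
    and "\<And>a b c. a < c \<Longrightarrow> c < b \<Longrightarrow> b < length xs \<Longrightarrow> xs ! a = xs ! b \<Longrightarrow> xs ! c = xs ! a"
  shows "distinct xs"
  unfolding distinct_conv_nth
proof (intro allI impI)
  have "xs ! a \<noteq> xs ! b" if "a < b" "b < length xs" for a b
  proof
    assume "xs ! a = xs ! b"
    moreover have "xs ! a \<noteq> xs ! Suc a"
      using assms(1) that by (intro distinct_adj_nth) auto
    ultimately show False
      using assms(2)[of a "Suc a" b] that by (metis Suc_lessI lessI)
  qed
  then show "xs ! i \<noteq> xs ! j" if "i < length xs" "j < length xs" "i \<noteq> j" for i j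
    using that by (metis linorder_neqE_nat)
qed

lemma prod_list_map2_power_concat:
  fixes xss :: "'a::comm_ring_1 list list"
  assumes "list_all2 (\<lambda>xs ms. length xs = length ms) xss mss"
  shows "prod_list (map2 (^) (concat xss) (concat mss))
    = prod_list (map2 (\<lambda>xs ms. prod_list (map2 (^) xs ms)) xss mss)"
  using assms by (induction rule: list_all2_induct) auto

subsection \<open>Fillings and their columns\<close>

text \<open>The range ends at the last nonempty column, in accordance with \<open>columns\<close>;
  empty columns further left appear as \<open>{}\<close>.\<close>

definition column_shapes :: "(nat \<times> nat) set \<Rightarrow> nat set list" where
  "column_shapes D = map (\<lambda>j. {i. (i, j) \<in> D}) [1..<Suc (Max (insert 0 (snd ` D)))]"

lemma map_dom_columns: "map dom (columns T) = column_shapes (dom T)"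
  by (auto simp: columns_def column_shapes_def num_columns_def simp del: upt_Suc)

lemma length_column_shapes: "length (column_shapes D) = Max (insert 0 (snd ` D))"
  by (simp add: column_shapes_def)

lemma nth_column_shapes:
  "q < length (column_shapes D) \<Longrightarrow> column_shapes D ! q = {i. (i, Suc q) \<in> D}"
  by (simp add: column_shapes_def nth_append del: upt_Suc)

lemma le_length_column_shapes: "diagram D \<Longrightarrow> (i, j) \<in> D \<Longrightarrow> j \<le> length (column_shapes D)"
  unfolding length_column_shapes diagram_def by (intro Max_ge) force+

lemma last_column_shapes:
  assumes "diagram D" "column_shapes D \<noteq> []"
  shows "last (column_shapes D) \<noteq> {}"
proof -
  let ?m = "Max (insert 0 (snd ` D))"
  have m: "?m \<noteq> 0"
    using assms(2) by (metis length_column_shapes length_0_conv)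
  have "?m \<in> insert 0 (snd ` D)"
    using assms(1) by (intro Max_in) (auto simp: diagram_def)
  with m obtain i where "(i, ?m) \<in> D"
    by force
  with m show ?thesis
    using assms(2) by (auto simp: last_conv_nth nth_column_shapes length_column_shapes)
qed

lemma dom_of_columns: "dom (of_columns Cs) = {(i, Suc j) | i j. j < length Cs \<and> i \<in> dom (Cs ! j)}"
proof (intro set_eqI iffI)
  fix p assume "p \<in> dom (of_columns Cs)"
  then show "p \<in> {(i, Suc j) | i j. j < length Cs \<and> i \<in> dom (Cs ! j)}"
    by (cases p; cases "snd p") (auto simp: of_columns_def split: if_splits)
qed (auto simp: of_columns_def)

lemma ran_of_columns: "ran (of_columns Cs) = (\<Union>C\<in>set Cs. ran C)"
proof (intro set_eqI iffI)
  fix v assume "v \<in> ran (of_columns Cs)"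
  then obtain i j where "1 \<le> j" "j \<le> length Cs" "(Cs ! (j - 1)) i = Some v"
    by (auto simp: ran_def of_columns_def split: if_splits)
  then have "Cs ! (j - 1) \<in> set Cs" "v \<in> ran (Cs ! (j - 1))"
    by (auto simp: ran_def)
  then show "v \<in> (\<Union>C\<in>set Cs. ran C)"
    by blast
next
  fix v assume "v \<in> (\<Union>C\<in>set Cs. ran C)"
  then obtain i j where "j < length Cs" "(Cs ! j) i = Some v"
    by (auto simp: ran_def in_set_conv_nth)
  then have "of_columns Cs (i, Suc j) = Some v"
    by (simp add: of_columns_def)
  then show "v \<in> ran (of_columns Cs)"
    by (rule ranI)
qed

text \<open>Trailing empty columns are all that \<open>of_columns\<close> forgets, and the
  assumption excludes them.\<close>

lemma columns_of_columns:
  assumes "Cs = [] \<or> dom (last Cs) \<noteq> {}"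
  shows "columns (of_columns Cs) = Cs"
proof -
  have "num_columns (of_columns Cs) = length Cs"
    unfolding num_columns_def
  proof (rule Max_eqI)
    have "snd ` dom (of_columns Cs) \<subseteq> {..length Cs}"
      by (auto simp: dom_of_columns)
    then show "finite (insert 0 (snd ` dom (of_columns Cs)))"
      by (metis finite.insertI finite_atMost finite_subset)
    show "y \<le> length Cs" if "y \<in> insert 0 (snd ` dom (of_columns Cs))" for y
      using that by (auto simp: dom_of_columns)
    show "length Cs \<in> insert 0 (snd ` dom (of_columns Cs))"
    proof (cases "Cs = []")
      case False
      with assms obtain i where "i \<in> dom (Cs ! (length Cs - 1))"
        by (auto simp: last_conv_nth)
      with False have "(i, length Cs) \<in> dom (of_columns Cs)"
        unfolding dom_of_columns by (intro CollectI exI[of _ i] exI[of _ "length Cs - 1"]) auto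
      then show ?thesis
        by force
    qed simp
  qed
  then show ?thesis
    by (intro nth_equalityI) (auto simp: columns_def of_columns_def nth_append simp del: upt_Suc)
qed

lemma dom_of_columns_eq:
  assumes "diagram D" "map dom Cs = column_shapes D"
  shows "dom (of_columns Cs) = D"
proof -
  have len: "length Cs = length (column_shapes D)"
    using assms(2) by (metis length_map)
  have nth: "dom (Cs ! q) = {i. (i, Suc q) \<in> D}" if "q < length Cs" for q
    using that assms(2) nth_column_shapes len by (metis nth_map)
  have "(i, j) \<in> dom (of_columns Cs) \<longleftrightarrow> (i, j) \<in> D" for i j
  proof
    assume "(i, j) \<in> D"
    then have "1 \<le> j" "j \<le> length Cs"
      using assms(1) le_length_column_shapes[OF assms(1)] by (auto simp: diagram_def len)
    then obtain q where "j = Suc q" "q < length Cs"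
      by (intro that[of "j - 1"]) auto
    with \<open>(i, j) \<in> D\<close> nth show "(i, j) \<in> dom (of_columns Cs)"
      unfolding dom_of_columns by blast
  next
    assume "(i, j) \<in> dom (of_columns Cs)"
    then obtain q where "j = Suc q" "q < length Cs" "i \<in> dom (Cs ! q)"
      unfolding dom_of_columns by blast
    with nth show "(i, j) \<in> D"
      by blast
  qed
  then show ?thesis
    by auto
qed

text \<open>Counted from 0, the copies of column \<open>r\<close> are the columns \<open>q\<close>
  with \<open>q div k = r\<close>; each \<open>Suc\<close> returns to counting from 1.\<close>

lemma mem_repeat_columns:
  assumes "diagram D" "1 \<le> k"
  shows "(i, Suc q) \<in> repeat_columns k D \<longleftrightarrow> (i, Suc (q div k)) \<in> D"
proof -
  have "k * j - k + 1 \<le> Suc q \<and> Suc q \<le> k * j \<longleftrightarrow> j = Suc (q div k)" if "1 \<le> j" for j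
  proof -
    obtain r where r: "j = Suc r"
      using \<open>1 \<le> j\<close> by (cases j) auto
    have "k * r \<le> q \<and> q < k + k * r \<longleftrightarrow> q div k = r"
      using assms(2) by (auto simp: dividend_less_times_div intro!: div_nat_eqI)
    then show ?thesis
      by (auto simp: r)
  qed
  then show ?thesis
    using assms(1) by (fastforce simp: repeat_columns_def diagram_def)
qed

lemma diagram_repeat_columns: "diagram D \<Longrightarrow> diagram (repeat_columns k D)"
  by (auto simp: diagram_def repeat_columns_def)

lemma column_shapes_repeat_columns:
  assumes D: "diagram D" and k: "1 \<le> k"
  shows "column_shapes (repeat_columns k D) = concat (map (replicate k) (column_shapes D))"
proof (rule nth_equalityI)
  let ?m = "Max (insert 0 (snd ` D))"
  \<comment> \<open>The last nonempty column moves to \<open>k\<close> times its position; the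
    inserted 0 covers the empty diagram.\<close>
  have max: "Max (insert 0 (snd ` repeat_columns k D)) = k * ?m"
  proof (rule Max_eqI)
    show "finite (insert 0 (snd ` repeat_columns k D))"
      using diagram_repeat_columns[OF D] by (auto simp: diagram_def)
    show "y \<le> k * ?m" if "y \<in> insert 0 (snd ` repeat_columns k D)" for y
    proof -
      have "y = 0 \<or> (\<exists>j. y \<le> k * j \<and> j \<in> snd ` D)"
        using that by (force simp: repeat_columns_def)
      moreover have "j \<le> ?m" if "j \<in> snd ` D" for j
        using that D by (intro Max_ge) (auto simp: diagram_def)
      ultimately show ?thesis
        by (metis le_trans mult_le_mono2 zero_le)
    qed
    have "?m \<in> insert 0 (snd ` D)"
      using D by (intro Max_in) (auto simp: diagram_def)
    then show "k * ?m \<in> insert 0 (snd ` repeat_columns k D)"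
    proof
      assume "?m \<in> snd ` D"
      then obtain i where "(i, ?m) \<in> D"
        by force
      moreover from this have "1 \<le> ?m"
        using D by (auto simp: diagram_def)
      moreover from this k have "k * ?m - k + 1 \<le> k * ?m"
        by (simp add: Suc_diff_le[symmetric])
      ultimately have "(i, k * ?m) \<in> repeat_columns k D"
        using k by (auto simp: repeat_columns_def intro!: bexI[of _ "(i, ?m)"])
      then show ?thesis
        by force
    qed simp
  qed
  show "length (column_shapes (repeat_columns k D)) = length (concat (map (replicate k) (column_shapes D)))"
    by (simp only: length_column_shapes max)
      (simp add: length_concat o_def sum_list_triv length_column_shapes)
  fix q assume q: "q < length (column_shapes (repeat_columns k D))"
  then have "q < k * length (column_shapes D)"
    by (simp only: length_column_shapes max)
  then show "column_shapes (repeat_columns k D) ! q = concat (map (replicate k) (column_shapes D)) ! q"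
    using q k mem_repeat_columns[OF D k]
    by (simp add: nth_concat_map_replicate nth_column_shapes less_mult_imp_div_less mult.commute)
qed

section \<open>Monomials of affine and linear statistics\<close>

lemma z_pow_sum: "z_pow (\<lambda>x. \<Sum>j\<in>J. f j x) = (\<Prod>j\<in>J. z_pow (f j))"
  unfolding z_pow_def power_sum by (rule prod.swap)

text \<open>The origin of the characteristic roots: one more copy of column \<open>j\<close>
  multiplies the monomial by \<open>z_pow (S j)\<close>.\<close>

lemma z_pow_affine:
  assumes "length ms = l"
  shows "z_pow (\<lambda>x. A x + (\<Sum>j<l. ms ! j * S j x))
    = z_pow A * prod_list (map2 (^) (map (\<lambda>j. z_pow (S j)) [0..<l]) ms)"
proof -
  have add: "z_pow (\<lambda>x. u x + v x) = z_pow u * z_pow v" for u v :: "'a \<Rightarrow> nat"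
    by (simp add: z_pow_def power_add prod.distrib)
  have scale: "z_pow (\<lambda>x. m * v x) = z_pow v ^ m" for m and v :: "'a \<Rightarrow> nat"
    by (simp add: z_pow_def prod_power_distrib mult.commute flip: power_mult)
  have "prod_list (map2 (^) (map (\<lambda>j. z_pow (S j)) [0..<l]) ms) = (\<Prod>j<l. z_pow (S j) ^ (ms ! j))"
    using assms by (simp add: prod.list_conv_set_nth atLeast0LessThan)
  then show ?thesis
    by (simp add: add z_pow_sum scale)
qed

lemma z_pow_linear_extension:
  "z_pow (linear_extension val T) = prod_list (map (\<lambda>C. z_pow (val C)) (columns T))"
  by (simp add: linear_extension_def z_pow_sum prod.list_conv_set_nth atLeast0LessThan)

section \<open>Compressed fillings of a fixed diagram\<close>

text \<open>\<open>es\<close> lists the shapes of the maximal blocks of equally shaped adjacent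
  columns of \<open>D\<close>, and \<open>ps\<close> their widths. A shape may recur in a later
  block.\<close>

locale block_family =
  fixes \<T> :: "filling set" and D :: "(nat \<times> nat) set" and n :: nat
    and ps :: "nat list" and es :: "nat set list"
  assumes closed: "weakly_column_closed \<T>"
    and behaved: "well_behaved \<T>"
    and diagram: "diagram D"
    and shapes: "column_shapes D = stretch ps es"
    and ps: "ps \<in> multiplicities (length es)"
    and es: "distinct_adj es"
begin

text \<open>No \<open>k\<close> occurs: by weak closure, membership in the family does not depend on
  the multiplicities. The list is nested so that each block can be given its own total.\<close>

definition compressed :: "column list list set" where
  "compressed = {css. list_all2 (\<lambda>cs e. dom ` set cs = {e}) css es \<and> (\<forall>cs\<in>set css. distinct cs) \<and>
     (\<forall>C\<in>set (concat css). ran C \<subseteq> {1..n}) \<and> of_columns (concat css) \<in> \<T>}"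

lemma last_es: "es \<noteq> [] \<Longrightarrow> last es \<noteq> {}"
proof -
  assume "es \<noteq> []"
  then have "column_shapes D \<noteq> []"
    using set_stretch[OF ps] by (auto simp flip: shapes)
  from last_column_shapes[OF diagram this] show "last es \<noteq> {}"
    using last_stretch[OF ps] shapes by simp
qed

text \<open>The last column has shape \<open>last es\<close>, which is nonempty. Hence
  \<open>of_columns\<close> is injective on the lists of columns considered here.\<close>

lemma columns_of_columns_stretch:
  assumes "map dom Cs = stretch ms es" "ms \<in> multiplicities (length es)"
  shows "columns (of_columns Cs) = Cs"
proof (intro columns_of_columns disjCI)
  assume "\<not> dom (last Cs) \<noteq> {}"
  show "Cs = []"
  proof (rule ccontr)
    assume "Cs \<noteq> []"
    then have "dom (last Cs) = last es"
      using assms last_stretch by (metis last_map)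
    moreover have "es \<noteq> []"
      using \<open>Cs \<noteq> []\<close> assms(1) by auto
    ultimately show False
      using last_es \<open>\<not> dom (last Cs) \<noteq> {}\<close> by simp
  qed
qed

lemma shapes_repeat:
  "1 \<le> k \<Longrightarrow> column_shapes (repeat_columns k D) = stretch (map ((*) k) ps) es"
  by (simp add: column_shapes_repeat_columns diagram shapes concat_map_replicate_stretch)

lemma repeat_multiplicities: "1 \<le> k \<Longrightarrow> map ((*) k) ps \<in> multiplicities (length es)"
  using ps by (auto simp: multiplicities_def)

lemma length_compressed: "css \<in> compressed \<Longrightarrow> length css = length ps"
  using ps by (auto simp: compressed_def multiplicities_def dest: list_all2_lengthD)

lemma columns_compressed: "css \<in> compressed \<Longrightarrow> columns (of_columns (concat css)) = concat css"
  using columns_of_columns_stretch map_concat_blocks[of dom css es] by (auto simp: compressed_def)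

lemma finite_fillings:
  "finite {T :: filling. dom T = D \<and> ran T \<subseteq> {1..n}}"
  using diagram by (intro finite_set_of_finite_maps) (auto simp: diagram_def)

text \<open>Shapes are finite and entries at most \<open>n\<close>, so there are finitely many
  columns; distinctness bounds the lengths of the blocks.\<close>

lemma finite_compressed: "finite compressed"
proof (rule finite_subset)
  let ?cols = "\<lambda>e. {C. dom C = e \<and> ran C \<subseteq> {1..n}}"
  let ?X = "listset (map (\<lambda>e. {cs. set cs \<subseteq> ?cols e \<and> distinct cs}) es)"
  show "compressed \<subseteq> ?X"
  proof
    fix css assume css: "css \<in> compressed"
    then have "list_all2 (\<lambda>cs e. dom ` set cs = {e}) css es"
      by (simp add: compressed_def)
    then have "list_all2 (\<lambda>cs e. cs \<in> {cs. set cs \<subseteq> ?cols e \<and> distinct cs}) css es"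
    proof (rule list.rel_mono_strong)
      fix cs e assume cs: "cs \<in> set css" "dom ` set cs = {e}"
      have "dom C = e" if "C \<in> set cs" for C
        using cs(2) that by (metis imageI singletonD)
      moreover have "ran C \<subseteq> {1..n}" if "C \<in> set cs" for C
        using css cs(1) that unfolding compressed_def set_concat by blast
      moreover have "distinct cs"
        using css cs(1) by (simp add: compressed_def)
      ultimately show "cs \<in> {cs. set cs \<subseteq> ?cols e \<and> distinct cs}"
        by blast
    qed
    then show "css \<in> ?X"
      by (simp add: listset_conv list.rel_map)
  qed
  have "finite e" if "e \<in> set es" for e
  proof -
    have "e \<in> set (column_shapes D)"
      using that by (simp add: shapes set_stretch[OF ps])
    then obtain j where "e = {i. (i, j) \<in> D}"
      by (auto simp: column_shapes_def)
    then have "e \<subseteq> fst ` D"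
      by force
    then show ?thesis
      using diagram by (meson diagram_def finite_imageI finite_subset)
  qed
  then show "finite ?X"
    by (auto intro!: finite_listset finite_subset_distinct finite_set_of_finite_maps)
qed

lemma fillings_of_eq:
  assumes k: "1 \<le> k"
  shows "fillings_of \<T> (repeat_columns k D) n = of_columns `
    {Cs. map dom Cs = stretch (map ((*) k) ps) es \<and> (\<forall>C\<in>set Cs. ran C \<subseteq> {1..n}) \<and> of_columns Cs \<in> \<T>}"
proof (intro equalityI subsetI)
  fix T assume T: "T \<in> fillings_of \<T> (repeat_columns k D) n"
  then have "is_filling T"
    by (simp add: fillings_of_def is_filling_def diagram_repeat_columns diagram)
  then have eq: "of_columns (columns T) = T"
    by (rule of_columns_columns)
  moreover have "map dom (columns T) = stretch (map ((*) k) ps) es"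
    using T by (simp add: fillings_of_def map_dom_columns shapes_repeat[OF k])
  moreover have "(\<Union>C\<in>set (columns T). ran C) \<subseteq> {1..n}"
    using T by (auto simp: eq fillings_of_def simp flip: ran_of_columns)
  ultimately show "T \<in> of_columns ` {Cs. map dom Cs = stretch (map ((*) k) ps) es \<and>
      (\<forall>C\<in>set Cs. ran C \<subseteq> {1..n}) \<and> of_columns Cs \<in> \<T>}"
    using T by (intro image_eqI[of _ _ "columns T"]) (auto simp: fillings_of_def)
next
  fix T assume "T \<in> of_columns ` {Cs. map dom Cs = stretch (map ((*) k) ps) es \<and>
      (\<forall>C\<in>set Cs. ran C \<subseteq> {1..n}) \<and> of_columns Cs \<in> \<T>}"
  then obtain Cs where Cs: "T = of_columns Cs" "map dom Cs = column_shapes (repeat_columns k D)"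
    "\<forall>C\<in>set Cs. ran C \<subseteq> {1..n}" "of_columns Cs \<in> \<T>"
    by (auto simp: shapes_repeat[OF k])
  have "dom T = repeat_columns k D"
    using Cs(2) by (simp add: Cs(1) dom_of_columns_eq diagram_repeat_columns diagram)
  moreover have "ran T \<subseteq> {1..n}"
    using Cs(3) by (auto simp: Cs(1) ran_of_columns)
  ultimately show "T \<in> fillings_of \<T> (repeat_columns k D) n"
    using Cs by (auto simp: fillings_of_def)
qed

lemma stretched_compressed_iff:
  assumes "list_all2 (\<lambda>cs e. dom ` set cs = {e}) css es" "1 \<le> k"
    and "mss \<in> block_multiplicities css (map ((*) k) ps)"
  shows "of_columns (concat (map2 stretch mss css)) \<in> \<T> \<longleftrightarrow> of_columns (concat css) \<in> \<T>"
    and "set (concat (map2 stretch mss css)) = set (concat css)"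
proof -
  have "length css = length (map ((*) k) ps)"
    using assms(1) ps by (auto simp: multiplicities_def dest: list_all2_lengthD)
  note * = concat_block_multiplicities[OF this assms(3)]
  show "of_columns (concat (map2 stretch mss css)) \<in> \<T> \<longleftrightarrow> of_columns (concat css) \<in> \<T>"
    using * closed unfolding weakly_column_closed_def by metis
  show "set (concat (map2 stretch mss css)) = set (concat css)"
    using * set_stretch by metis
qed

text \<open>The unique compression of a filling. Run-length encoding gives surjectivity once
  well-behavedness has made the columns of each block distinct, and distinctness in turn gives
  injectivity.\<close>

lemma bij_betw_compressed:
  assumes k: "1 \<le> k"
  shows "bij_betw (\<lambda>(css, mss). concat (map2 stretch mss css))
    (SIGMA css:compressed. block_multiplicities css (map ((*) k) ps))
    {Cs. map dom Cs = stretch (map ((*) k) ps) es \<and> (\<forall>C\<in>set Cs. ran C \<subseteq> {1..n}) \<and> of_columns Cs \<in> \<T>}"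
    (is "bij_betw ?f ?A ?B")
  unfolding bij_betw_def
proof (intro conjI equalityI subsetI)
  show "inj_on ?f ?A"
  proof (rule inj_onI, clarify)
    fix css mss css' mss'
    assume "css \<in> compressed" "mss \<in> block_multiplicities css (map ((*) k) ps)"
      "css' \<in> compressed" "mss' \<in> block_multiplicities css' (map ((*) k) ps)"
      "concat (map2 stretch mss css) = concat (map2 stretch mss' css')"
    then show "css = css' \<and> mss = mss'"
      by (intro blocks_inject[of css "map ((*) k) ps"])
        (auto simp: length_compressed, auto simp: compressed_def)
  qed
  have len: "length (map ((*) k) ps) = length es"
    using ps by (simp add: multiplicities_def)
  fix Cs
  {
    assume "Cs \<in> ?f ` ?A"
    then obtain css mss where *: "css \<in> compressed"
      "mss \<in> block_multiplicities css (map ((*) k) ps)" "Cs = concat (map2 stretch mss css)"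
      by auto
    from *(1) have css: "list_all2 (\<lambda>cs e. dom ` set cs = {e}) css es"
      by (simp add: compressed_def)
    show "Cs \<in> ?B"
      using *(1) map_block_stretch[OF css len *(2)] stretched_compressed_iff[OF css k *(2)]
      unfolding *(3) compressed_def by simp
  }
  {
    assume Cs: "Cs \<in> ?B"
    then obtain css mss where *: "list_all2 (\<lambda>cs e. dom ` set cs = {e}) css es"
      "\<forall>cs\<in>set css. distinct_adj cs" "mss \<in> block_multiplicities css (map ((*) k) ps)"
      "Cs = concat (map2 stretch mss css)"
      using ex_blocks[OF repeat_multiplicities[OF k]] by blast
    note iff = stretched_compressed_iff[OF *(1) k *(3)]
    have T: "of_columns (concat css) \<in> \<T>"
      using Cs iff(1) *(4) by simp
    have cols: "columns (of_columns (concat css)) = concat css"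
      using columns_of_columns_stretch map_concat_blocks[OF *(1)] by blast
    \<comment> \<open>Clause (i) of well-behavedness is applied to the compressed filling itself,
      which lies in the family by weak closure.\<close>
    have contiguous: "concat css ! c = concat css ! a"
      if "a < c" "c < b" "b < length (concat css)" "concat css ! a = concat css ! b" for a b c
      using bspec[OF behaved[unfolded well_behaved_def] T, THEN conjunct1, unfolded cols] that
      by blast
    have "distinct cs" if cs: "cs \<in> set css" for cs
    proof (rule distinct_if_contiguous)
      show "distinct_adj cs"
        using *(2) cs by blast
      fix a b c assume abc: "a < c" "c < b" "b < length cs" "cs ! a = cs ! b"
      obtain xs ys where "css = xs @ cs # ys"
        using cs by (auto simp: in_set_conv_decomp)
      \<comment> \<open>Positions in a block are positions in the whole list up to a constant
        offset, so contiguity is inherited by each block.\<close>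
      then have "cs ! i = concat css ! (length (concat xs) + i)"
        "length (concat xs) + i < length (concat css)" if "i < length cs" for i
        using that by (auto simp: nth_append)
      then show "cs ! c = cs ! a"
        using abc contiguous[of "length (concat xs) + a" "length (concat xs) + c"
            "length (concat xs) + b"] by auto
    qed
    then have "css \<in> compressed"
      using * T iff(2) Cs by (auto simp: compressed_def)
    with * show "Cs \<in> ?f ` ?A"
      by force
  }
qed

text \<open>The outer index set is independent of \<open>k\<close>, so it suffices to annihilate
  each inner sum.\<close>

lemma sum_fillings_of:
  fixes w :: "filling \<Rightarrow> 'r::comm_ring_1"
  assumes k: "1 \<le> k"
  shows "(\<Sum>T\<in>fillings_of \<T> (repeat_columns k D) n. w T)
    = (\<Sum>css\<in>compressed. \<Sum>mss\<in>block_multiplicities css (map ((*) k) ps).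
        w (of_columns (concat (map2 stretch mss css))))"
proof -
  let ?B = "{Cs. map dom Cs = stretch (map ((*) k) ps) es \<and> (\<forall>C\<in>set Cs. ran C \<subseteq> {1..n}) \<and>
    of_columns Cs \<in> \<T>}"
  have "inj_on of_columns ?B"
    by (rule inj_on_inverseI[of _ columns])
      (auto intro: columns_of_columns_stretch repeat_multiplicities k)
  then have "(\<Sum>T\<in>fillings_of \<T> (repeat_columns k D) n. w T) = (\<Sum>Cs\<in>?B. w (of_columns Cs))"
    unfolding fillings_of_eq[OF k] by (simp add: sum.reindex)
  also have "\<dots> = (\<Sum>(css, mss)\<in>(SIGMA css:compressed. block_multiplicities css (map ((*) k) ps)).
      w (of_columns (concat (map2 stretch mss css))))"
    unfolding sum.reindex_bij_betw[OF bij_betw_compressed[OF k], symmetric] split_def ..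
  also have "\<dots> = (\<Sum>css\<in>compressed. \<Sum>mss\<in>block_multiplicities css (map ((*) k) ps).
        w (of_columns (concat (map2 stretch mss css))))"
    by (intro sum.Sigma[symmetric]) (auto simp: finite_compressed finite_block_multiplicities)
  finally show ?thesis .
qed

text \<open>One element per block, repeated to the width of the block in \<open>D\<close>. It is
  polymorphic in order to apply both to columns and to their monomials.\<close>

abbreviation stretched_choices :: "'a list list \<Rightarrow> 'a list list" where
  "stretched_choices xss \<equiv> map (stretch ps) (product_lists xss)"

section \<open>Recurrences for the generating functions\<close>

text \<open>The constant monomial \<open>z_pow A\<close> factors out and the remaining sum splits
  into a product of composition sums, one for each block. \<open>xss\<close> holds the monomials of
  the columns, grouped like \<open>css\<close>.\<close>

lemma annihilates_compressed_sum:
  fixes \<sigma> :: "filling \<Rightarrow> 's::finite \<Rightarrow> nat"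
  assumes css: "css \<in> compressed"
    and affine: "\<And>ms x. ms \<in> multiplicities (length (concat css)) \<Longrightarrow>
      \<sigma> (of_columns (stretch ms (concat css))) x = A x + (\<Sum>j<length (concat css). ms ! j * S j x)"
    and xss: "concat xss = map (\<lambda>j. z_pow (S j)) [0..<length (concat css)]"
      "map length xss = map length css"
  shows "annihilates (poly_of_roots (map prod_list (stretched_choices xss)))
    (\<lambda>k. \<Sum>mss\<in>block_multiplicities css (map ((*) (Suc k)) ps).
      z_pow (\<sigma> (of_columns (concat (map2 stretch mss css)))))"
proof -
  have len: "length css = length ps" "length xss = length ps"
    using length_compressed[OF css] xss(2) by (auto dest: map_eq_imp_length_eq)
  have "(\<Sum>mss\<in>block_multiplicities css (map ((*) (Suc k)) ps).
        z_pow (\<sigma> (of_columns (concat (map2 stretch mss css)))))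
      = z_pow A * prod_list (map2 (\<lambda>xs p. composition_sum xs (Suc k * p)) xss ps)" for k
  proof -
    let ?Ns = "map ((*) (Suc k)) ps"
    let ?M = "block_multiplicities css ?Ns"
    \<comment> \<open>Only the lengths of the blocks matter here, so \<open>css\<close> may be
      exchanged for \<open>xss\<close>.\<close>
    have M: "?M = listset (map2 (\<lambda>xs N. compositions (length xs) N) xss ?Ns)"
    proof -
      have "map2 (\<lambda>cs N. compositions (length cs) N) css ?Ns
          = map2 (\<lambda>l N. compositions l N) (map length css) ?Ns"
        by (simp add: zip_map1 split_def)
      also have "\<dots> = map2 (\<lambda>xs N. compositions (length xs) N) xss ?Ns"
        unfolding xss(2)[symmetric] by (simp add: zip_map1 split_def)
      finally show ?thesis
        by (simp add: block_multiplicities_def)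
    qed
    have "z_pow (\<sigma> (of_columns (concat (map2 stretch mss css))))
        = z_pow A * prod_list (map2 (\<lambda>xs ms. prod_list (map2 (^) xs ms)) xss mss)"
      if mss: "mss \<in> ?M" for mss
    proof -
      have *: "concat mss \<in> multiplicities (length (concat css))"
        "concat (map2 stretch mss css) = stretch (concat mss) (concat css)"
        using concat_block_multiplicities[of css ?Ns mss] len mss by simp_all
      have "\<sigma> (of_columns (stretch (concat mss) (concat css)))
          = (\<lambda>x. A x + (\<Sum>j<length (concat css). concat mss ! j * S j x))"
        using affine[OF *(1)] by auto
      then have "z_pow (\<sigma> (of_columns (concat (map2 stretch mss css))))
          = z_pow A * prod_list (map2 (^) (concat xss) (concat mss))"
        by (simp only: *(2) xss(1) z_pow_affine[OF length_multiplicities[OF *(1)]])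
      also have "list_all2 (\<lambda>xs ms. length xs = length ms) xss mss"
        using mss len unfolding M
        by (auto simp: listset_conv list_all2_conv_all_nth compositions_def multiplicities_def)
      note prod_list_map2_power_concat[OF this]
      finally show ?thesis .
    qed
    then have "(\<Sum>mss\<in>?M. z_pow (\<sigma> (of_columns (concat (map2 stretch mss css)))))
        = z_pow A * (\<Sum>mss\<in>?M. prod_list (map2 (\<lambda>xs ms. prod_list (map2 (^) xs ms)) xss mss))"
      by (simp add: sum_distrib_left)
    also have "(\<Sum>mss\<in>?M. prod_list (map2 (\<lambda>xs ms. prod_list (map2 (^) xs ms)) xss mss))
        = prod_list (map2 (\<lambda>xs p. composition_sum xs (Suc k * p)) xss ps)"
      unfolding M using len
      by (subst sum_listset_prod_list)
        (auto simp: sum_compositions intro!: arg_cong[of _ _ prod_list] nth_equalityI)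
    finally show ?thesis .
  qed
  \<comment> \<open>A block realizes exactly one shape, so it contains a column; the recurrence for
    composition sums is stated for nonempty lists.\<close>
  moreover have "[] \<notin> set xss"
  proof -
    have "map length css \<in> multiplicities (length es)"
      using css map_concat_blocks by (auto simp: compressed_def)
    then have "0 \<notin> set (map length xss)"
      unfolding xss(2) by (auto simp: multiplicities_def)
    then show ?thesis
      by force
  qed
  moreover have "ps \<in> multiplicities (length xss)"
    using ps len by (simp add: multiplicities_def)
  ultimately show ?thesis
    using annihilates_scale[OF annihilates_prod_composition_sum[of ps xss]] by simp
qed

lemma recurrence_affine:
  fixes \<sigma> :: "filling \<Rightarrow> 's::finite \<Rightarrow> nat"
  assumes "affine_statistic \<T> \<sigma>"
  shows "\<exists>p. satisfies_recurrence 1 (\<lambda>k. H_poly \<T> \<sigma> n (repeat_columns k D)) p"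
proof -
  let ?a = "\<lambda>css k. \<Sum>mss\<in>block_multiplicities css (map ((*) (Suc k)) ps).
      z_pow (\<sigma> (of_columns (concat (map2 stretch mss css))))"
  have "\<exists>xs. annihilates (poly_of_roots xs) (?a css)" if css: "css \<in> compressed" for css
  proof -
    have "of_columns (concat css) \<in> \<T>"
      using css by (simp add: compressed_def)
    from bspec[OF assms[unfolded affine_statistic_def] this, unfolded columns_compressed[OF css]]
    obtain A S where AS:
      "\<And>ms x. ms \<in> multiplicities (length (concat css)) \<Longrightarrow>
        \<sigma> (of_columns (stretch ms (concat css))) x = A x + (\<Sum>j<length (concat css). ms ! j * S j x)"
      by blast
    obtain xss where xss: "concat xss = map (\<lambda>j. z_pow (S j)) [0..<length (concat css)]"
      "map length xss = map length css"
      using ex_concat_map_length[of "map (\<lambda>j. z_pow (S j)) [0..<length (concat css)]"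
          "map length css"] by (auto simp: length_concat)
    show ?thesis
      using annihilates_compressed_sum[where \<sigma> = \<sigma>, OF css AS xss] by blast
  qed
  then obtain roots where roots: "\<And>css. css \<in> compressed \<Longrightarrow>
      annihilates (poly_of_roots (roots css)) (?a css)"
    by metis
  \<comment> \<open>The roots vary with the compressed filling; the product is a common multiple of
    the finitely many polynomials.\<close>
  let ?p = "\<Prod>css\<in>compressed. poly_of_roots (roots css)"
  have "annihilates ?p (\<lambda>k. \<Sum>css\<in>compressed. ?a css k)"
    by (rule annihilates_sum, rule annihilates_dvd[OF roots])
      (auto intro: dvd_prodI finite_compressed)
  then have "satisfies_recurrence 1 (\<lambda>k. H_poly \<T> \<sigma> n (repeat_columns k D)) ?p"
    by (intro satisfies_recurrence_1I lead_coeff_monic_prod lead_coeff_poly_of_roots)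
      (simp add: H_poly_def sum_fillings_of)
  then show ?thesis
    by blast
qed

text \<open>Repeating the chosen columns to the widths \<open>ps\<close> restores the shape
  \<open>D\<close>. The filling from which they arise by deletion has the same compressed form, with
  enough copies of each chosen column.\<close>

lemma stretched_choices_root_fillings:
  assumes css: "css \<in> compressed" and Cs: "Cs \<in> set (stretched_choices css)"
  shows "of_columns Cs \<in> root_fillings \<T> D n" "columns (of_columns Cs) = Cs"
proof -
  obtain ys where ys: "Cs = stretch ps ys" "list_all2 (\<lambda>y cs. y \<in> set cs) ys css"
    using Cs by (auto simp: product_lists_set)
  have dom_css: "list_all2 (\<lambda>cs e. dom ` set cs = {e}) css es"
    using css by (simp add: compressed_def)
  have "dom (ys ! i) = es ! i" if "i < length es" for i
  proof -
    have "ys ! i \<in> set (css ! i)" "dom ` set (css ! i) = {es ! i}"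
      using dom_css ys(2) that by (auto simp only: list_all2_conv_all_nth)
    then show ?thesis
      by (metis imageI singletonD)
  qed
  then have dom_ys: "map dom ys = es"
    using dom_css ys(2) by (intro nth_equalityI) (auto simp only: list_all2_conv_all_nth length_map nth_map)
  then have dom_Cs: "map dom Cs = stretch ps es"
    by (simp add: ys(1) map_stretch)
  show cols: "columns (of_columns Cs) = Cs"
    using columns_of_columns_stretch[OF dom_Cs ps] .
  have ps': "ps \<in> multiplicities (length ys)"
    using ps dom_ys by (metis length_map)
  \<comment> \<open>A common bound for the lengths of all blocks.\<close>
  define K where "K = sum_list (map length css)"
  have "\<forall>cs\<in>set css. length cs \<le> K"
    by (auto simp: K_def intro!: member_le_sum_list)
  from ex_subseq_blocks[OF ys(2) ps' this] obtain mss where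
    mss: "mss \<in> block_multiplicities css (map ((*) (Suc K)) ps)"
    "subseq Cs (concat (map2 stretch mss css))"
    unfolding ys(1) by blast
  let ?Us = "concat (map2 stretch mss css)"
  have "?Us \<in> {Cs. map dom Cs = stretch (map ((*) (Suc K)) ps) es \<and>
      (\<forall>C\<in>set Cs. ran C \<subseteq> {1..n}) \<and> of_columns Cs \<in> \<T>}"
    using bij_betw_apply[OF bij_betw_compressed[of "Suc K"], of "(css, mss)"] css mss(1) by simp
  then have U: "of_columns ?Us \<in> fillings_of \<T> (repeat_columns (Suc K) D) n"
    "columns (of_columns ?Us) = ?Us"
    using columns_of_columns_stretch[OF _ repeat_multiplicities[of "Suc K"]]
    by (auto simp: fillings_of_eq[of "Suc K"] simp del: set_concat)
  have "dom (of_columns Cs) = D"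
    using dom_Cs by (intro dom_of_columns_eq) (simp_all add: diagram shapes)
  \<comment> \<open>Adjacent blocks have different shapes, so equally shaped neighbours come from
    the same block and are copies of one chosen column.\<close>
  moreover have "Cs ! j = Cs ! Suc j" if "Suc j < length Cs" "dom (Cs ! j) = dom (Cs ! Suc j)" for j
    using successively_stretch[OF ps', of dom] es that
    by (simp add: dom_ys ys(1) successively_conv_nth)
  ultimately show "of_columns Cs \<in> root_fillings \<T> D n"
    using U mss(2) unfolding root_fillings_def
    by (intro CollectI conjI exI[of _ "Suc K"] bexI[of _ "of_columns ?Us"] exI[of _ Cs])
      (auto simp: cols)
qed

text \<open>Deleting columns creates no new entries, so all entries remain at most \<open>n\<close>.
  Finiteness matters because a product over an infinite set would be 1 by convention.\<close>

lemma finite_root_fillings: "finite (root_fillings \<T> D n)"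
proof (rule finite_subset[OF _ finite_fillings], clarify)
  fix T assume T: "T \<in> root_fillings \<T> D n"
  then obtain k U Cs where U: "U \<in> fillings_of \<T> (repeat_columns k D) n"
    "subseq Cs (columns U)" "T = of_columns Cs"
    unfolding root_fillings_def by blast
  have "is_filling U"
    using U(1) by (simp add: fillings_of_def is_filling_def diagram_repeat_columns diagram)
  then have "ran U = (\<Union>C\<in>set (columns U). ran C)"
    by (metis of_columns_columns ran_of_columns)
  moreover have "set Cs \<subseteq> set (columns U)"
    using U(2) by (blast elim: list_emb_set)
  ultimately have "ran T \<subseteq> ran U"
    by (auto simp: U(3) ran_of_columns)
  then show "dom T = D \<and> ran T \<subseteq> {1..n}"
    using T U(1) by (auto simp: root_fillings_def fillings_of_def)
qed

text \<open>Each compressed filling is handled separately: its choices are distinct root fillings,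
  so its polynomial divides the full product. Several compressed fillings may share a root filling;
  divisibility lets it count only once.\<close>

lemma recurrence_linear:
  fixes \<sigma> :: "filling \<Rightarrow> 's::finite \<Rightarrow> nat"
  assumes "linear_statistic \<T> \<sigma> val"
  shows "satisfies_recurrence 1 (\<lambda>k. H_poly \<T> \<sigma> n (repeat_columns k D))
    (\<Prod>T\<in>root_fillings \<T> D n. [:- z_pow (linear_extension val T), 1:])"
    (is "satisfies_recurrence 1 _ ?p")
proof -
  let ?a = "\<lambda>css k. \<Sum>mss\<in>block_multiplicities css (map ((*) (Suc k)) ps).
      z_pow (\<sigma> (of_columns (concat (map2 stretch mss css))))"
  let ?z = "\<lambda>C. z_pow (val C)"
  have "annihilates ?p (?a css)" if css: "css \<in> compressed" for css
  proof (rule annihilates_dvd)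
    let ?xss = "map (map ?z) css"
    have T: "of_columns (concat css) \<in> \<T>"
      using css by (simp add: compressed_def)
    \<comment> \<open>Linearity is the affine form with constant vector 0 and with step vectors that
      depend on the column only.\<close>
    have "\<sigma> (of_columns (stretch ms (concat css))) x
        = 0 + (\<Sum>j<length (concat css). ms ! j * val (concat css ! j) x)"
      if "ms \<in> multiplicities (length (concat css))" for ms x
      using assms T that columns_compressed[OF css] unfolding linear_statistic_def
      by (metis add_0)
    moreover have "map ?z Cs = map (\<lambda>j. ?z (Cs ! j)) [0..<length Cs]" for Cs
      by (rule nth_equalityI) auto
    from this[of "concat css"]
    have "concat ?xss = map (\<lambda>j. ?z (concat css ! j)) [0..<length (concat css)]"
      by (simp only: map_concat)
    ultimately show "annihilates (poly_of_roots (map prod_list (stretched_choices ?xss))) (?a css)"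
      by (intro annihilates_compressed_sum[OF css, where A = "\<lambda>_. 0"]) auto
    \<comment> \<open>Blocks without repetitions give pairwise different choices, so the product
      over the list of choices is a product over a set.\<close>
    have "distinct (product_lists css)"
      using css by (intro distinct_product_lists) (auto simp: compressed_def)
    moreover have "set (product_lists css) \<subseteq> {ys. length ys = length es}"
      using length_compressed[OF css] ps
      by (auto simp: multiplicities_def dest: in_set_product_lists_length)
    ultimately have distinct: "distinct (stretched_choices css)"
      using inj_on_stretch[OF ps] by (auto simp: distinct_map intro: inj_on_subset)
    have inj: "inj_on of_columns (set (stretched_choices css))"
      by (rule inj_on_inverseI[of _ columns]) (rule stretched_choices_root_fillings[OF css])
    have "poly_of_roots (map prod_list (stretched_choices ?xss))
        = (\<Prod>Cs\<leftarrow>stretched_choices css. [:- prod_list (map ?z Cs), 1:])"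
      by (simp add: poly_of_roots_def product_lists_map o_def map_stretch)
    also have "\<dots> = (\<Prod>Cs\<in>set (stretched_choices css). [:- prod_list (map ?z Cs), 1:])"
      using distinct by (rule prod.distinct_set_conv_list[symmetric])
    also have "\<dots> = (\<Prod>Cs\<in>set (stretched_choices css).
        [:- z_pow (linear_extension val (of_columns Cs)), 1:])"
      by (intro prod.cong)
        (simp_all only: z_pow_linear_extension stretched_choices_root_fillings(2)[OF css])
    also have "\<dots> = (\<Prod>T\<in>of_columns ` set (stretched_choices css).
        [:- z_pow (linear_extension val T), 1:])"
      by (simp add: prod.reindex[OF inj] del: set_map)
    also have "\<dots> dvd ?p"
      using stretched_choices_root_fillings(1)[OF css]
      by (intro prod_dvd_prod_subset finite_root_fillings) blast
    finally show "poly_of_roots (map prod_list (stretched_choices ?xss)) dvd ?p" .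
  qed
  then have "annihilates ?p (\<lambda>k. \<Sum>css\<in>compressed. ?a css k)"
    by (rule annihilates_sum)
  then show ?thesis
    by (intro satisfies_recurrence_1I lead_coeff_monic_prod)
      (simp_all add: H_poly_def sum_fillings_of)
qed

end

section \<open>Strict column closure\<close>

lemma strictly_column_closed_subseq:
  assumes "strictly_column_closed \<T>" "subseq xs ys" "of_columns ys \<in> \<T>"
  shows "of_columns xs \<in> \<T>"
proof -
  have del: "of_columns (as @ bs) \<in> \<T>" if "of_columns (as @ c # bs) \<in> \<T>" for as bs c
    using assms(1) that unfolding strictly_column_closed_def
    by (auto dest!: spec[of _ "as @ c # bs"] spec[of _ "length as"])
  \<comment> \<open>The prefix \<open>as\<close> collects the columns already kept, so that
    deletions further right still concern a full filling of the family.\<close>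
  have "of_columns (as @ xs) \<in> \<T>" if "of_columns (as @ ys) \<in> \<T>" for as
    using assms(2) that
  proof (induction arbitrary: as rule: list_emb.induct)
    case (list_emb_Nil ys)
    then show ?case
      by (induction ys) (auto intro: del)
  next
    case (list_emb_Cons xs ys y)
    then show ?case
      using del by blast
  next
    case (list_emb_Cons2 x y xs ys)
    then show ?case
      using list_emb_Cons2.IH[of "as @ [x]"] by simp
  qed
  from this[of "[]"] assms(3) show ?thesis
    by simp
qed

lemma root_fillings_subset:
  assumes "strictly_column_closed \<T>" "diagram D"
  shows "root_fillings \<T> D n \<subseteq> fillings_of \<T> D n"
proof
  fix T assume T: "T \<in> root_fillings \<T> D n"
  then obtain k U Cs where U: "U \<in> fillings_of \<T> (repeat_columns k D) n"
    "subseq Cs (columns U)" "T = of_columns Cs"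
    unfolding root_fillings_def by blast
  have "is_filling U"
    using U(1) assms(2) by (simp add: fillings_of_def is_filling_def diagram_repeat_columns)
  then have cols: "of_columns (columns U) = U"
    by (rule of_columns_columns)
  have "T \<in> \<T>"
    using U assms(1) by (auto simp: fillings_of_def cols intro: strictly_column_closed_subseq)
  moreover have "ran T \<subseteq> ran (of_columns (columns U))"
    using U(2) unfolding U(3) ran_of_columns by (blast elim: list_emb_set)
  ultimately show "T \<in> fillings_of \<T> D n"
    using T U(1) by (auto simp: root_fillings_def fillings_of_def cols)
qed

theorem proposition6:
  fixes \<T> :: "filling set"
    and \<sigma> :: "filling \<Rightarrow> 's::finite \<Rightarrow> nat"
    and D :: "(nat \<times> nat) set"
    and n :: nat
  assumes "\<forall>T \<in> \<T>. is_filling T"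
    and "weakly_column_closed \<T>"
    and "well_behaved \<T>"
    and "affine_statistic \<T> \<sigma>"
    and "diagram D"
    and "n \<ge> 1"
  shows "(\<exists>p. satisfies_recurrence 1 (\<lambda>k. H_poly \<T> \<sigma> n (repeat_columns k D)) p) \<and>
    (\<forall>val. linear_statistic \<T> \<sigma> val \<longrightarrow>
       satisfies_recurrence 1 (\<lambda>k. H_poly \<T> \<sigma> n (repeat_columns k D))
         (\<Prod>T \<in> root_fillings \<T> D n. [:- z_pow (linear_extension val T), 1:])) \<and>
    (strictly_column_closed \<T> \<longrightarrow> root_fillings \<T> D n \<subseteq> fillings_of \<T> D n)"
proof -
  \<comment> \<open>The run-length encoding of the column shapes of \<open>D\<close> supplies its
    blocks.\<close>
  obtain ps where ps: "ps \<in> multiplicities (length (remdups_adj (column_shapes D)))"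
    "column_shapes D = stretch ps (remdups_adj (column_shapes D))"
    using ex_stretch_remdups_adj by blast
  interpret block_family \<T> D n ps "remdups_adj (column_shapes D)"
    using assms(2,3,5) ps by unfold_locales auto
  show ?thesis
    using recurrence_affine[OF assms(4)] recurrence_linear root_fillings_subset[OF _ assms(5)]
    by blast
qed

end
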